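(* Let $A$, $B$ be connected, locally finite graphs, where $B$ has at least two vertices, and let $\{A_i\mid i\in I\}$ be a transitive family of subsets that partitions (the vertex set of) $A$. If $B$ is vertex-transitive, $I$ is infinite, and the quotient graph $\mathcal I$ is locally finite, then the wreath product $B\wr_I A$ with respect to the family $\{A_i\mid i\in I\}$ has linear divergence.
   Context: **Transitive family.** The family $\{A_i\mid i\in I\}$ partitioning $A$ is transitive if for all vertices $a_1,a_2\in A$ there is an isometry $\phi_{a_1,a_2}$ of $A$ that preserves the partition and sends $a_1$ to $a_2$. **Wreath product with respect to the family.** Fix a vertex $b_0$ of $B$. The support of $f:I\to B$ is $\{i\in I\mid f(i)\neq b_0\}$. The vertices of $B\wr_I A$ are the pairs $(f,a)$, where $a$ is a vertex of $A$ and $f$ is a function from $I$ to the vertex set of $B$ with finite support. There are two types of edges: type (1) edges connect $(f_1,a_1)$ and $(f_2,a_2)$ if $a_1=a_2$ and there is $j\in I$ with $a_1\in A_j$ such that $f_1(i)=f_2(i)$ for all $i\neq j$ and $f_1(j)$ is adjacent to $f_2(j)$ in $B$; type (2) edges connect $(f_1,a_1)$ and $(f_2,a_2)$ if $f_1=f_2$ and $a_1$ is adjacent to $a_2$ in $A$. **Quotient graph $\mathcal I$.** Its vertices are the elements of $I$; two vertices $i\neq j$ are joined by an edge iff some element of $A_i$ is adjacent in $A$ to some element of $A_j$; there are no edges from a vertex to itself. **Divergence.** Let $X$ be a geodesic metric space (connected graphs are viewed as geodesic metric spaces with edges of length $1$), $\delta\in(0,1)$, $\gamma\geq 0$. For $a,b,c\in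 X$ put $r=\min\{\operatorname{dist}(c,a),\operatorname{dist}(c,b)\}$ and let $\operatorname{div}_\gamma(a,b,c;\delta)$ be the infimum of the lengths of paths connecting $a$ to $b$ in $X\setminus B(c,\delta r-\gamma)$, where $B(\cdot,\cdot)$ denotes the open ball (empty if the radius is non-positive); it is $\infty$ if there is no such path. Put $\operatorname{Div}_\gamma(n,\delta)=\sup\{\operatorname{div}_\gamma(a,b,c;\delta): a,b,c\in X,\ \operatorname{dist}(a,b)\leq n\}$. For functions $f,g$ on $\mathbb R_+$ write $f\preceq g$ if there is $A\geq 1$ with $f(x)\leq A g(Ax+A)+Ax+A$ for all $x\in\mathbb R_+$, and $f\asymp g$ if $f\preceq g$ and $g\preceq f$. The space $X$ has *linear divergence* if $\operatorname{Div}_\gamma(n,\delta)\asymp n$ for some $\delta\in(0,1)$ and $\gamma\geq 0$. (For one-ended connected locally finite vertex-transitive graphs it is known that $\operatorname{Div}_\gamma(n,\delta)$ does not depend, up to $\asymp$, on $\delta\leq 1/2$ and $\gamma\geq 2$.) *)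

theory Defs
  imports "HOL-Analysis.Analysis"
begin

section \<open>Graphs\<close>

record 'v graph =
  verts :: "'v set"
  edges :: "('v \<times> 'v) set"

definition simple_graph :: "'v graph \<Rightarrow> bool" where
  "simple_graph G \<longleftrightarrow> edges G \<subseteq> verts G \<times> verts G \<and> sym (edges G) \<and> irrefl (edges G)"

definition connected_graph :: "'v graph \<Rightarrow> bool" where
  "connected_graph G \<longleftrightarrow> (\<forall>u\<in>verts G. \<forall>v\<in>verts G. (u, v) \<in> (edges G)\<^sup>*)"

definition locally_finite :: "'v graph \<Rightarrow> bool" where
  "locally_finite G \<longleftrightarrow> (\<forall>u\<in>verts G. finite {v. (u, v) \<in> edges G})"

definition graph_dist :: "'v graph \<Rightarrow> 'v \<Rightarrow> 'v \<Rightarrow> nat" where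
  "graph_dist G u v = (LEAST n. (u, v) \<in> edges G ^^ n)"

definition graph_isometry :: "'v graph \<Rightarrow> ('v \<Rightarrow> 'v) \<Rightarrow> bool" where
  "graph_isometry G \<phi> \<longleftrightarrow> bij_betw \<phi> (verts G) (verts G) \<and>
     (\<forall>u\<in>verts G. \<forall>v\<in>verts G. graph_dist G (\<phi> u) (\<phi> v) = graph_dist G u v)"

definition graph_automorphism :: "'v graph \<Rightarrow> ('v \<Rightarrow> 'v) \<Rightarrow> bool" where
  "graph_automorphism G \<phi> \<longleftrightarrow> bij_betw \<phi> (verts G) (verts G) \<and>
     (\<forall>u\<in>verts G. \<forall>v\<in>verts G. (\<phi> u, \<phi> v) \<in> edges G \<longleftrightarrow> (u, v) \<in> edges G)"

definition vertex_transitive :: "'v graph \<Rightarrow> bool" where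
  "vertex_transitive G \<longleftrightarrow>
     (\<forall>u\<in>verts G. \<forall>v\<in>verts G. \<exists>\<phi>. graph_automorphism G \<phi> \<and> \<phi> u = v)"


section \<open>Partitions, quotient graphs and wreath products\<close>

definition partitions :: "'i set \<Rightarrow> ('i \<Rightarrow> 'a set) \<Rightarrow> 'a set \<Rightarrow> bool" where
  "partitions I P S \<longleftrightarrow> (\<Union>i\<in>I. P i) = S \<and> disjoint_family_on P I \<and> (\<forall>i\<in>I. P i \<noteq> {})"

definition transitive_family :: "'a graph \<Rightarrow> 'i set \<Rightarrow> ('i \<Rightarrow> 'a set) \<Rightarrow> bool" where
  "transitive_family A I P \<longleftrightarrow>
     (\<forall>a\<^sub>1\<in>verts A. \<forall>a\<^sub>2\<in>verts A. \<exists>\<phi>. graph_isometry A \<phi> \<and>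
        (\<forall>i\<in>I. \<exists>j\<in>I. \<phi> ` P i = P j) \<and> \<phi> a\<^sub>1 = a\<^sub>2)"

definition quotient_graph :: "'a graph \<Rightarrow> 'i set \<Rightarrow> ('i \<Rightarrow> 'a set) \<Rightarrow> 'i graph" where
  "quotient_graph A I P =
     \<lparr>verts = I,
      edges = {(i, j). i \<in> I \<and> j \<in> I \<and> i \<noteq> j \<and> (\<exists>a\<in>P i. \<exists>a'\<in>P j. (a, a') \<in> edges A)}\<rparr>"

text \<open>
  Functions from \<open>I\<close> to the vertices of \<open>B\<close> are extensional, so that they are determined by their
  values on \<open>I\<close>.
\<close>

definition wreath_verts ::
    "'b graph \<Rightarrow> 'b \<Rightarrow> 'a graph \<Rightarrow> 'i set \<Rightarrow> (('i \<Rightarrow> 'b) \<times> 'a) set" where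
  "wreath_verts B b\<^sub>0 A I =
     {f \<in> I \<rightarrow>\<^sub>E verts B. finite {i \<in> I. f i \<noteq> b\<^sub>0}} \<times> verts A"

definition wreath_product ::
    "'b graph \<Rightarrow> 'b \<Rightarrow> 'a graph \<Rightarrow> 'i set \<Rightarrow> ('i \<Rightarrow> 'a set) \<Rightarrow> (('i \<Rightarrow> 'b) \<times> 'a) graph" where
  "wreath_product B b\<^sub>0 A I P =
     \<lparr>verts = wreath_verts B b\<^sub>0 A I,
      edges = {((f\<^sub>1, a\<^sub>1), (f\<^sub>2, a\<^sub>2)).
        (f\<^sub>1, a\<^sub>1) \<in> wreath_verts B b\<^sub>0 A I \<and> (f\<^sub>2, a\<^sub>2) \<in> wreath_verts B b\<^sub>0 A I \<and>
        ((a\<^sub>1 = a\<^sub>2 \<and> (\<exists>j\<in>I. a\<^sub>1 \<in> P j \<and> (\<forall>i\<in>I - {j}. f\<^sub>1 i = f\<^sub>2 i) \<and> (f\<^sub>1 j, f\<^sub>2 j) \<in> edges B)) \<or>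
         (f\<^sub>1 = f\<^sub>2 \<and> (a\<^sub>1, a\<^sub>2) \<in> edges A))}\<rparr>"


section \<open>Geometric realization\<close>

text \<open>
  A point is given by its barycentric coordinates: a vertex is the indicator function of itself,
  and the point at distance \<open>t\<close> from \<open>u\<close> on the edge \<open>{u, v}\<close> has coordinates \<open>1 - t\<close> at \<open>u\<close>
  and \<open>t\<close> at \<open>v\<close>.
\<close>

definition supp :: "('v \<Rightarrow> real) \<Rightarrow> 'v set" where
  "supp x = {v. x v \<noteq> 0}"

definition realization_points :: "'v graph \<Rightarrow> ('v \<Rightarrow> real) set" where
  "realization_points G =
     {x. (\<forall>v. 0 \<le> x v) \<and> sum x (supp x) = 1 \<and>
         ((\<exists>v\<in>verts G. supp x = {v}) \<or> (\<exists>u v. (u, v) \<in> edges G \<and> supp x = {u, v}))}"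

text \<open>
  The lengths of the direct routes from \<open>x\<close> to \<open>y\<close>. Such a route leaves the cell of \<open>x\<close> through
  one of its vertices \<open>u\<close>, follows a shortest edge path to a vertex \<open>v\<close> of the cell of \<open>y\<close> and
  goes on to \<open>y\<close>, or it stays inside an edge containing both \<open>x\<close> and \<open>y\<close>. The path metric is the
  length of the shortest one.
\<close>

definition route_lengths :: "'v graph \<Rightarrow> ('v \<Rightarrow> real) \<Rightarrow> ('v \<Rightarrow> real) \<Rightarrow> real set" where
  "route_lengths G x y =
     {(1 - x u) + real (graph_dist G u v) + (1 - y v) |u v. u \<in> supp x \<and> v \<in> supp y} \<union>
     {\<bar>x u - y u\<bar> |u v. (u, v) \<in> edges G \<and> supp x \<union> supp y \<subseteq> {u, v}}"

text \<open>
  \<^const>\<open>Metric_space\<close> requires nonnegativity and symmetry outside the carrier as well, hence the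
  default value \<open>0\<close>.
\<close>

definition realization_dist :: "'v graph \<Rightarrow> ('v \<Rightarrow> real) \<Rightarrow> ('v \<Rightarrow> real) \<Rightarrow> real" where
  "realization_dist G x y =
     (if x \<in> realization_points G \<and> y \<in> realization_points G then Inf (route_lengths G x y) else 0)"

definition realization :: "'v graph \<Rightarrow> ('v \<Rightarrow> real) metric" where
  "realization G = metric (realization_points G, realization_dist G)"

context
  fixes G :: "'v graph"
  assumes simple: "simple_graph G" and conn: "connected_graph G"
begin

lemma edge_verts: "(u, v) \<in> edges G \<Longrightarrow> u \<in> verts G \<and> v \<in> verts G \<and> u \<noteq> v \<and> (v, u) \<in> edges G"
  using simple by (auto simp: simple_graph_def sym_def irrefl_def)

lemma graph_dist_walk:
  assumes "u \<in> verts G" "v \<in> verts G"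
  shows "(u, v) \<in> edges G ^^ graph_dist G u v"
  unfolding graph_dist_def
  using assms conn by (auto simp: connected_graph_def rtrancl_power intro: LeastI_ex)

lemma graph_dist_le: "(u, v) \<in> edges G ^^ n \<Longrightarrow> graph_dist G u v \<le> n"
  unfolding graph_dist_def by (rule Least_le)

lemma graph_dist_refl [simp]: "graph_dist G u u = 0"
  using graph_dist_le[of u u 0] by simp

lemma graph_dist_edge: "(u, v) \<in> edges G \<Longrightarrow> graph_dist G u v \<le> 1"
  using graph_dist_le[of u v 1] by simp

lemma graph_dist_eq_0: "u \<in> verts G \<Longrightarrow> v \<in> verts G \<Longrightarrow> graph_dist G u v = 0 \<Longrightarrow> u = v"
  using graph_dist_walk[of u v] by simp

lemma graph_dist_triangle:
  assumes "u \<in> verts G" "v \<in> verts G" "w \<in> verts G"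
  shows "graph_dist G u w \<le> graph_dist G u v + graph_dist G v w"
  using assms graph_dist_walk by (intro graph_dist_le) (auto simp: relpow_add)

lemma graph_dist_sym:
  assumes "u \<in> verts G" "v \<in> verts G"
  shows "graph_dist G u v = graph_dist G v u"
proof -
  have rev: "(v, u) \<in> edges G ^^ n" if "(u, v) \<in> edges G ^^ n" for u v n
    using that by (induction n arbitrary: v) (auto intro: relpow_Suc_I2 dest: edge_verts simp del: relpow.simps(2) elim!: relpow_Suc_E)
  have "graph_dist G v u \<le> graph_dist G u v" if "u \<in> verts G" "v \<in> verts G" for u v
    by (rule graph_dist_le[OF rev[OF graph_dist_walk[OF that]]])
  then show ?thesis
    using assms by (simp add: antisym)
qed

lemma point_nonneg: "x \<in> realization_points G \<Longrightarrow> 0 \<le> x v"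
  by (auto simp: realization_points_def)

lemma point_zero: "v \<notin> supp x \<Longrightarrow> x v = 0"
  by (auto simp: supp_def)

lemma point_verts: "x \<in> realization_points G \<Longrightarrow> v \<in> supp x \<Longrightarrow> v \<in> verts G"
  using edge_verts by (auto simp: realization_points_def)

lemma point_finite: "x \<in> realization_points G \<Longrightarrow> finite (supp x)"
  by (auto simp: realization_points_def)

lemma point_nonempty: "x \<in> realization_points G \<Longrightarrow> supp x \<noteq> {}"
  by (auto simp: realization_points_def)

lemma point_le_1:
  assumes "x \<in> realization_points G"
  shows "x v \<le> 1"
proof (cases "v \<in> supp x")
  case True
  then have "x v \<le> sum x (supp x)"
    using assms by (intro member_le_sum point_finite) (auto simp: point_nonneg)
  then show ?thesis
    using assms by (simp add: realization_points_def)
qed (simp add: point_zero)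

lemma point_sum:
  assumes "x \<in> realization_points G" "supp x \<subseteq> {u, v}" "u \<noteq> v"
  shows "x u + x v = 1"
proof -
  have "sum x (supp x) = sum x {u, v}"
    using assms(2) by (intro sum.mono_neutral_left) (auto simp: point_zero)
  then show ?thesis
    using assms by (simp add: realization_points_def)
qed

lemma point_edge:
  assumes "x \<in> realization_points G" "u \<in> supp x" "v \<in> supp x" "u \<noteq> v"
  shows "(u, v) \<in> edges G" "supp x = {u, v}" "x u + x v = 1"
proof -
  have "(u, v) \<in> edges G \<and> supp x = {u, v}"
  proof -
    have "\<not> (\<exists>w. supp x = {w})"
      using assms(2-4) by auto
    then obtain p q where pq: "(p, q) \<in> edges G" "supp x = {p, q}"
      using assms(1) by (auto simp: realization_points_def)
    then have "u = p \<and> v = q \<or> u = q \<and> v = p"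
      using assms(2-4) by auto
    then show ?thesis
      using pq edge_verts[of p q] by auto
  qed
  then show "(u, v) \<in> edges G" "supp x = {u, v}" "x u + x v = 1"
    using assms point_sum by auto
qed

lemma point_vertex:
  assumes "x \<in> realization_points G" "supp x \<subseteq> {v}"
  shows "supp x = {v}" "x v = 1"
  using assms point_nonempty[of x] by (auto simp: realization_points_def subset_singleton_iff)

lemma route_nonneg:
  assumes "x \<in> realization_points G" "y \<in> realization_points G" "r \<in> route_lengths G x y"
  shows "0 \<le> r"
proof -
  have "0 \<le> (1 - x u) + real (graph_dist G u v) + (1 - y v)" for u v
    using point_le_1[OF assms(1), of u] point_le_1[OF assms(2), of v] by simp
  then show ?thesis
    using assms(3) by (auto simp only: route_lengths_def Un_iff mem_Collect_eq abs_ge_zero)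
qed

lemma route_bdd_below:
  "x \<in> realization_points G \<Longrightarrow> y \<in> realization_points G \<Longrightarrow> bdd_below (route_lengths G x y)"
  by (rule bdd_belowI[of _ 0]) (rule route_nonneg)

lemma route_nonempty:
  "x \<in> realization_points G \<Longrightarrow> y \<in> realization_points G \<Longrightarrow> route_lengths G x y \<noteq> {}"
  using point_nonempty[of x] point_nonempty[of y] by (auto simp: route_lengths_def)

lemma route_finite:
  assumes "x \<in> realization_points G" "y \<in> realization_points G"
  shows "finite (route_lengths G x y)"
proof (rule finite_subset)
  let ?S = "supp x" and ?T = "supp y"
  let ?f = "\<lambda>(u, v). (1 - x u) + real (graph_dist G u v) + (1 - y v)"
  show "route_lengths G x y \<subseteq> ?f ` (?S \<times> ?T) \<union> insert 0 ((\<lambda>u. \<bar>x u - y u\<bar>) ` (?S \<union> ?T))"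
  proof
    fix r assume "r \<in> route_lengths G x y"
    then consider
      (vertices) u v where "u \<in> ?S" "v \<in> ?T" "r = ?f (u, v)"
    | (edge) u where "r = \<bar>x u - y u\<bar>"
      by (auto simp: route_lengths_def)
    then show "r \<in> ?f ` (?S \<times> ?T) \<union> insert 0 ((\<lambda>u. \<bar>x u - y u\<bar>) ` (?S \<union> ?T))"
    proof cases
      case vertices
      then show ?thesis
        by blast
    next
      case (edge u)
      then show ?thesis
        by (cases "u \<in> ?S \<union> ?T") (auto simp: point_zero)
    qed
  qed
  show "finite (?f ` (?S \<times> ?T) \<union> insert 0 ((\<lambda>u. \<bar>x u - y u\<bar>) ` (?S \<union> ?T)))"
    using assms point_finite by simp
qed

lemma route_sym_subset:
  assumes "x \<in> realization_points G" "y \<in> realization_points G"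
  shows "route_lengths G x y \<subseteq> route_lengths G y x"
proof
  fix r assume "r \<in> route_lengths G x y"
  then consider
    (vertices) u v where "u \<in> supp x" "v \<in> supp y"
      "r = (1 - x u) + real (graph_dist G u v) + (1 - y v)"
  | (edge) u v where "(u, v) \<in> edges G" "supp x \<union> supp y \<subseteq> {u, v}" "r = \<bar>x u - y u\<bar>"
    by (auto simp: route_lengths_def)
  then show "r \<in> route_lengths G y x"
  proof cases
    case vertices
    then have "r = (1 - y v) + real (graph_dist G v u) + (1 - x u)"
      using graph_dist_sym point_verts assms by simp
    then show ?thesis
      using vertices unfolding route_lengths_def by blast
  next
    case edge
    then have "r = \<bar>y u - x u\<bar>" "supp y \<union> supp x \<subseteq> {u, v}"
      by auto
    then show ?thesis
      using edge unfolding route_lengths_def by blast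
  qed
qed

lemma vertex_route:
  "u \<in> supp x \<Longrightarrow> v \<in> supp y \<Longrightarrow>
   (1 - x u) + real (graph_dist G u v) + (1 - y v) \<in> route_lengths G x y"
  unfolding route_lengths_def by blast

lemma edge_route:
  "(u, v) \<in> edges G \<Longrightarrow> supp x \<subseteq> {u, v} \<Longrightarrow> supp y \<subseteq> {u, v} \<Longrightarrow>
   \<bar>x u - y u\<bar> \<in> route_lengths G x y"
  unfolding route_lengths_def by blast

lemma route_vertex_vertex:
  assumes x: "x \<in> realization_points G" and y: "y \<in> realization_points G"
    and z: "z \<in> realization_points G"
    and s: "u \<in> supp x" "v \<in> supp y" "v' \<in> supp y" "w \<in> supp z"
  shows "\<exists>t\<in>route_lengths G x z.
    t \<le> ((1 - x u) + real (graph_dist G u v) + (1 - y v)) +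
        ((1 - y v') + real (graph_dist G v' w) + (1 - z w))"
proof (rule bexI[OF _ vertex_route[OF s(1,4)]])
  have V: "u \<in> verts G" "v \<in> verts G" "v' \<in> verts G" "w \<in> verts G"
    using s x y z point_verts by auto
  have "real (graph_dist G v v') \<le> (1 - y v) + (1 - y v')"
  proof (cases "v = v'")
    case True
    then show ?thesis
      using point_le_1[OF y, of v] by simp
  next
    case False
    then show ?thesis
      using point_edge[OF y s(2,3)] graph_dist_edge[of v v'] by simp
  qed
  moreover have "graph_dist G u w \<le> graph_dist G u v + graph_dist G v v' + graph_dist G v' w"
    using graph_dist_triangle[OF V(1,2,4)] graph_dist_triangle[OF V(2,3,4)] by simp
  then have "real (graph_dist G u w) \<le>
      real (graph_dist G u v) + real (graph_dist G v v') + real (graph_dist G v' w)"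
    by (metis of_nat_add of_nat_mono)
  ultimately show "(1 - x u) + real (graph_dist G u w) + (1 - z w) \<le>
      ((1 - x u) + real (graph_dist G u v) + (1 - y v)) +
      ((1 - y v') + real (graph_dist G v' w) + (1 - z w))"
    by linarith
qed

lemma route_vertex_edge:
  assumes x: "x \<in> realization_points G" and y: "y \<in> realization_points G"
    and z: "z \<in> realization_points G"
    and s: "u \<in> supp x" "v \<in> supp y"
    and e: "(p, q) \<in> edges G" "supp y \<subseteq> {p, q}" "supp z \<subseteq> {p, q}"
  shows "\<exists>t\<in>route_lengths G x z.
    t \<le> ((1 - x u) + real (graph_dist G u v) + (1 - y v)) + \<bar>y p - z p\<bar>"
proof -
  have pq: "p \<noteq> q" "(q, p) \<in> edges G"
    using e edge_verts by auto
  have "y p + y q = 1" "z p + z q = 1"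
    using point_sum e pq y z by auto
  then have q: "\<bar>y p - z p\<bar> = \<bar>y q - z q\<bar>"
    by linarith
  have "v = p \<or> v = q"
    using s(2) e(2) by auto
  then obtain v' where v': "v = p \<and> v' = q \<or> v = q \<and> v' = p" "(v, v') \<in> edges G"
      "\<bar>y p - z p\<bar> = \<bar>y v - z v\<bar>"
    using e(1) pq q by metis
  show ?thesis
  proof (cases "v \<in> supp z")
    case True
    show ?thesis
      by (rule bexI[OF _ vertex_route[OF s(1) True]]) (use v'(3) in linarith)
  next
    case False
    then have "supp z \<subseteq> {v'}"
      using e(3) v'(1) by auto
    then have z': "supp z = {v'}" "z v' = 1"
      using point_vertex[OF z] by simp_all
    have "v \<in> verts G" "v' \<in> verts G" "u \<in> verts G"
      using v'(2) edge_verts point_verts x s by auto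
    then have "graph_dist G u v' \<le> graph_dist G u v + 1"
      using graph_dist_triangle[of u v v'] graph_dist_edge[OF v'(2)] by simp
    then have "real (graph_dist G u v') \<le> real (graph_dist G u v) + 1"
      by linarith
    moreover have "z v = 0"
      using False by (simp add: point_zero)
    moreover have "v' \<in> supp z"
      using z' by simp
    ultimately show ?thesis
      using v'(3) z' point_nonneg[OF y, of v]
      by (intro bexI[OF _ vertex_route[OF s(1) \<open>v' \<in> supp z\<close>]]) simp
  qed
qed

lemma edge_route_to_vertex:
  assumes x: "x \<in> realization_points G" and y: "y \<in> realization_points G" "supp y = {v}"
    and e: "(p, q) \<in> edges G" "supp x \<subseteq> {p, q}" "supp y \<subseteq> {p, q}"
  shows "\<exists>u\<in>supp x. (1 - x u) + real (graph_dist G u v) + (1 - y v) \<le> \<bar>x p - y p\<bar>"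
proof -
  have pq: "p \<noteq> q" "(q, p) \<in> edges G"
    using e edge_verts by auto
  have "x p + x q = 1" "y p + y q = 1"
    using point_sum e pq x y by auto
  then have q: "\<bar>x p - y p\<bar> = \<bar>x q - y q\<bar>"
    by linarith
  have yv: "y v = 1"
    using point_vertex y by auto
  have "v = p \<or> v = q"
    using y(2) e(3) by auto
  then obtain v' where v': "v = p \<and> v' = q \<or> v = q \<and> v' = p" "(v', v) \<in> edges G"
      "\<bar>x p - y p\<bar> = \<bar>x v - y v\<bar>"
    using e(1) pq q by metis
  show ?thesis
  proof (cases "v \<in> supp x")
    case True
    then show ?thesis
      using v'(3) yv by (intro bexI[of _ v]) auto
  next
    case False
    then have "supp x \<subseteq> {v'}"
      using e(2) v'(1) by auto
    then have "supp x = {v'}" "x v' = 1" "x v = 0"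
      using point_vertex[OF x] False by (simp_all add: point_zero)
    then show ?thesis
      using v'(3) yv graph_dist_edge[OF v'(2)] by (intro bexI[of _ v']) auto
  qed
qed

lemma route_edge_edge:
  assumes x: "x \<in> realization_points G" and y: "y \<in> realization_points G"
    and z: "z \<in> realization_points G"
    and e: "(p, q) \<in> edges G" "supp x \<subseteq> {p, q}" "supp y \<subseteq> {p, q}"
    and e': "(p', q') \<in> edges G" "supp y \<subseteq> {p', q'}" "supp z \<subseteq> {p', q'}"
  shows "\<exists>t\<in>route_lengths G x z. t \<le> \<bar>x p - y p\<bar> + \<bar>y p' - z p'\<bar>"
proof (cases "{p, q} = {p', q'}")
  case True
  have "p \<noteq> q"
    using e edge_verts by auto
  have "y p + y q = 1" "z p + z q = 1"
    using point_sum e e' True \<open>p \<noteq> q\<close> y z by auto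
  then have "\<bar>y p' - z p'\<bar> = \<bar>y p - z p\<bar>"
    using True by (auto simp: doubleton_eq_iff)
  then show ?thesis
    using e e' True by (intro bexI[OF _ edge_route[of p q]]) auto
next
  case False
  have "p \<noteq> q" "p' \<noteq> q'"
    using e e' edge_verts by auto
  then obtain v where "supp y \<subseteq> {v}"
    using False e e' by (metis (no_types, lifting) doubleton_eq_iff insert_iff singletonD subset_iff)
  then have v: "supp y = {v}"
    using point_vertex y by auto
  from edge_route_to_vertex[OF x y v e] obtain u where u: "u \<in> supp x"
      "(1 - x u) + real (graph_dist G u v) + (1 - y v) \<le> \<bar>x p - y p\<bar>" ..
  have "v \<in> supp y"
    using v by simp
  from route_vertex_edge[OF x y z u(1) this e'] obtain t where "t \<in> route_lengths G x z"
      "t \<le> ((1 - x u) + real (graph_dist G u v) + (1 - y v)) + \<bar>y p' - z p'\<bar>" ..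
  then show ?thesis
    using u(2) by (intro bexI[of _ t]) linarith+
qed

lemma route_triangle:
  assumes x: "x \<in> realization_points G" and y: "y \<in> realization_points G"
    and z: "z \<in> realization_points G"
    and r: "r \<in> route_lengths G x y" and s: "s \<in> route_lengths G y z"
  shows "\<exists>t\<in>route_lengths G x z. t \<le> r + s"
proof -
  consider
    (vv) u v v' w where "u \<in> supp x" "v \<in> supp y" "v' \<in> supp y" "w \<in> supp z"
      "r = (1 - x u) + real (graph_dist G u v) + (1 - y v)"
      "s = (1 - y v') + real (graph_dist G v' w) + (1 - z w)"
  | (ve) u v p q where "u \<in> supp x" "v \<in> supp y" "(p, q) \<in> edges G"
      "supp y \<subseteq> {p, q}" "supp z \<subseteq> {p, q}"
      "r = (1 - x u) + real (graph_dist G u v) + (1 - y v)" "s = \<bar>y p - z p\<bar>"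
  | (ev) v w p q where "v \<in> supp y" "w \<in> supp z" "(p, q) \<in> edges G"
      "supp x \<subseteq> {p, q}" "supp y \<subseteq> {p, q}"
      "r = \<bar>x p - y p\<bar>" "s = (1 - y v) + real (graph_dist G v w) + (1 - z w)"
  | (ee) p q p' q' where "(p, q) \<in> edges G" "supp x \<subseteq> {p, q}" "supp y \<subseteq> {p, q}"
      "(p', q') \<in> edges G" "supp y \<subseteq> {p', q'}" "supp z \<subseteq> {p', q'}"
      "r = \<bar>x p - y p\<bar>" "s = \<bar>y p' - z p'\<bar>"
  proof -
    have 1: "(\<exists>u v. u \<in> supp x \<and> v \<in> supp y \<and>
          r = (1 - x u) + real (graph_dist G u v) + (1 - y v)) \<or>
        (\<exists>p q. (p, q) \<in> edges G \<and> supp x \<subseteq> {p, q} \<and> supp y \<subseteq> {p, q} \<and> r = \<bar>x p - y p\<bar>)"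
      using r unfolding route_lengths_def Un_iff mem_Collect_eq Un_subset_iff by metis
    have 2: "(\<exists>u v. u \<in> supp y \<and> v \<in> supp z \<and>
          s = (1 - y u) + real (graph_dist G u v) + (1 - z v)) \<or>
        (\<exists>p q. (p, q) \<in> edges G \<and> supp y \<subseteq> {p, q} \<and> supp z \<subseteq> {p, q} \<and> s = \<bar>y p - z p\<bar>)"
      using s unfolding route_lengths_def Un_iff mem_Collect_eq Un_subset_iff by metis
    from 1 2 show thesis
      by (elim disjE exE conjE) (rule vv ve ev ee; assumption)+
  qed
  then show ?thesis
  proof cases
    case vv
    then show ?thesis
      using route_vertex_vertex[OF x y z] by simp
  next
    case ve
    then show ?thesis
      using route_vertex_edge[OF x y z] by simp
  next
    case ev
    have "v \<in> verts G" "w \<in> verts G"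
      using ev point_verts y z by auto
    then have "s = (1 - z w) + real (graph_dist G w v) + (1 - y v)"
      using ev graph_dist_sym by simp
    moreover have "r = \<bar>y p - x p\<bar>"
      using ev by simp
    ultimately obtain t where "t \<in> route_lengths G z x" "t \<le> s + r"
      using route_vertex_edge[OF z y x ev(2,1,3,5,4)] by auto
    then show ?thesis
      using route_sym_subset[OF z x] by (auto simp: add.commute)
  next
    case ee
    then show ?thesis
      using route_edge_edge[OF x y z] by simp
  qed
qed

lemma route_zero:
  assumes x: "x \<in> realization_points G" and y: "y \<in> realization_points G"
    and r: "0 \<in> route_lengths G x y"
  shows "x = y"
proof -
  from r consider
    (vertices) u v where "u \<in> supp x" "v \<in> supp y"
      "0 = (1 - x u) + real (graph_dist G u v) + (1 - y v)"
  | (edge) u v where "(u, v) \<in> edges G" "supp x \<union> supp y \<subseteq> {u, v}" "x u = y u"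
    by (auto simp: route_lengths_def)
  then show ?thesis
  proof cases
    case vertices
    have "0 \<le> 1 - x u" "0 \<le> 1 - y v"
      using point_le_1 x y by auto
    then have one: "x u = 1" "y v = 1" "graph_dist G u v = 0"
      using vertices(3) by linarith+
    then have "u = v"
      using graph_dist_eq_0 vertices point_verts x y by blast
    have only: "supp z = {u}" if z: "z \<in> realization_points G" "z u = 1" for z
    proof -
      have "u \<in> supp z"
        using z by (simp add: supp_def)
      moreover have "w = u" if w: "w \<in> supp z" for w
      proof (rule ccontr)
        assume "w \<noteq> u"
        then have "z w = 0"
          using point_edge(3)[OF z(1) \<open>u \<in> supp z\<close> w] z(2) by simp
        then show False
          using w by (simp add: supp_def)
      qed
      ultimately show ?thesis
        by blast
    qed
    have "x w = y w" for w
    proof (cases "w = u")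
      case True
      then show ?thesis
        using one \<open>u = v\<close> by simp
    next
      case False
      then have "w \<notin> supp x" "w \<notin> supp y"
        using only[OF x] only[OF y] one \<open>u = v\<close> by auto
      then show ?thesis
        by (simp add: point_zero)
    qed
    then show ?thesis
      by blast
  next
    case edge
    have "u \<noteq> v"
      using edge edge_verts by auto
    then have "x u + x v = 1" "y u + y v = 1"
      using edge(2) point_sum[OF x] point_sum[OF y] by simp_all
    then have "x v = y v"
      using edge(3) by simp
    have "x w = y w" for w
    proof (cases "w \<in> {u, v}")
      case True
      then show ?thesis
        using edge(3) \<open>x v = y v\<close> by auto
    next
      case False
      then have "w \<notin> supp x" "w \<notin> supp y"
        using edge(2) by auto
      then show ?thesis
        by (simp add: point_zero)
    qed
    then show ?thesis
      by blast
  qed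
qed

lemma route_self:
  assumes x: "x \<in> realization_points G"
  shows "0 \<in> route_lengths G x x"
proof (cases "\<exists>u v. (u, v) \<in> edges G \<and> supp x = {u, v}")
  case True
  then obtain u v where "(u, v) \<in> edges G" "supp x = {u, v}"
    by blast
  then show ?thesis
    using edge_route[of u v x x] by simp
next
  case False
  then obtain v where "supp x = {v}"
    using x by (auto simp: realization_points_def)
  then show ?thesis
    using point_vertex[OF x, of v] vertex_route[of v x v x] by simp
qed

theorem Metric_space_realization: "Metric_space (realization_points G) (realization_dist G)"
proof
  fix x y
  show "0 \<le> realization_dist G x y"
    unfolding realization_dist_def
    using route_nonempty route_nonneg by (auto intro!: cInf_greatest)
  show "realization_dist G x y = realization_dist G y x"
    unfolding realization_dist_def
    using route_sym_subset[of x y] route_sym_subset[of y x] by (auto dest: antisym)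
next
  fix x y assume xy: "x \<in> realization_points G" "y \<in> realization_points G"
  have fin: "finite (route_lengths G x y)" "route_lengths G x y \<noteq> {}"
    using xy route_finite route_nonempty by auto
  show "realization_dist G x y = 0 \<longleftrightarrow> x = y"
  proof
    assume "realization_dist G x y = 0"
    then show "x = y"
      using xy fin Min_in[OF fin] route_zero[OF xy] by (simp add: realization_dist_def cInf_eq_Min)
  next
    assume "x = y"
    then have "Inf (route_lengths G x y) = 0"
      using xy route_self route_nonneg by (intro cInf_eq_minimum) auto
    then show "realization_dist G x y = 0"
      using xy by (simp add: realization_dist_def)
  qed
next
  fix x y z
  assume x: "x \<in> realization_points G" and y: "y \<in> realization_points G"
    and z: "z \<in> realization_points G"
  have *: "Inf (route_lengths G x z) \<le> r + s"
    if "r \<in> route_lengths G x y" "s \<in> route_lengths G y z" for r s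
    using route_triangle[OF x y z that] route_bdd_below[OF x z] by (meson cInf_lower2)
  have "Inf (route_lengths G x z) - s \<le> Inf (route_lengths G x y)" if "s \<in> route_lengths G y z" for s
    using *[OF _ that] route_nonempty[OF x y] by (intro cInf_greatest) (auto simp: algebra_simps)
  then have "Inf (route_lengths G x z) - Inf (route_lengths G x y) \<le> s"
    if "s \<in> route_lengths G y z" for s
    using that by (auto simp: algebra_simps)
  then have "Inf (route_lengths G x z) - Inf (route_lengths G x y) \<le> Inf (route_lengths G y z)"
    using route_nonempty[OF y z] by (intro cInf_greatest) auto
  then show "realization_dist G x z \<le> realization_dist G x y + realization_dist G y z"
    using x y z by (simp add: realization_dist_def)
qed

end


section \<open>Divergence\<close>

text \<open>The supremum ranges over all finite subdivisions \<open>ts\<close> of the unit interval.\<close>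

definition path_length :: "'x metric \<Rightarrow> (real \<Rightarrow> 'x) \<Rightarrow> ennreal" where
  "path_length X g =
     (SUP ts\<in>{ts. sorted ts \<and> set ts \<subseteq> {0..1}}.
        \<Sum>k<length ts - 1. ennreal (mdist X (g (ts ! k)) (g (ts ! Suc k))))"

definition div_at :: "'x metric \<Rightarrow> real \<Rightarrow> real \<Rightarrow> 'x \<Rightarrow> 'x \<Rightarrow> 'x \<Rightarrow> ennreal" where
  "div_at X \<gamma> \<delta> a b c =
     (let r = min (mdist X c a) (mdist X c b);
          Y = subtopology (mtopology_of X) (mspace X - mball_of X c (\<delta> * r - \<gamma>))
      in INF g\<in>{g. pathin Y g \<and> g 0 = a \<and> g 1 = b}. path_length X g)"

definition Div :: "'x metric \<Rightarrow> real \<Rightarrow> real \<Rightarrow> real \<Rightarrow> ennreal" where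
  "Div X \<gamma> \<delta> n =
     (SUP (a, b, c)\<in>{(a, b, c). a \<in> mspace X \<and> b \<in> mspace X \<and> c \<in> mspace X \<and> mdist X a b \<le> n}.
        div_at X \<gamma> \<delta> a b c)"

definition preceq :: "(real \<Rightarrow> ennreal) \<Rightarrow> (real \<Rightarrow> ennreal) \<Rightarrow> bool" where
  "preceq f g \<longleftrightarrow>
     (\<exists>K\<ge>1. \<forall>x\<ge>0. f x \<le> ennreal K * g (K * x + K) + ennreal (K * x + K))"

definition asymp_equiv_fun :: "(real \<Rightarrow> ennreal) \<Rightarrow> (real \<Rightarrow> ennreal) \<Rightarrow> bool" where
  "asymp_equiv_fun f g \<longleftrightarrow> preceq f g \<and> preceq g f"

definition linear_divergence :: "'x metric \<Rightarrow> bool" where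
  "linear_divergence X \<longleftrightarrow>
     (\<exists>\<delta> \<gamma>. 0 < \<delta> \<and> \<delta> < 1 \<and> 0 \<le> \<gamma> \<and> asymp_equiv_fun (Div X \<gamma> \<delta>) (\<lambda>n. ennreal n))"

end

theory Submission
  imports Defs
begin

text \<open>
  Let \<open>c\<close> be the centre of a ball of radius \<open>N\<close> in \<open>W\<close>. A vertex of \<open>W\<close> lies outside the ball if its
  walker stands in a cell far from the walker of \<open>c\<close>, or if a lamp over such a far cell differs from
  the lamp of \<open>c\<close>. Since \<open>\<I>\<close> is infinite, connected and locally finite and the family is transitive,
  the walker can reach a far cell by a path of length at most \<open>M * N\<close>; a start at distance at least
  \<open>(M + 1) * N\<close> from \<open>c\<close> keeps this path outside the ball. There it changes the lamp of the far cell,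
  after which every walk that leaves this lamp alone stays outside the ball. Doing this at both
  endpoints yields a detour whose length is linear in \<open>N\<close> and in the distance of the endpoints. The
  divergence is then linear for every \<open>\<delta>\<close> that is small compared with \<open>1 / M\<close>.
\<close>

section \<open>Walks of bounded length\<close>

text \<open>Only an upper bound on the number of steps is recorded, since graph maps may collapse
  edges and the final estimates need no exact lengths.\<close>

definition walk_le :: "('v \<times> 'v) set \<Rightarrow> nat \<Rightarrow> 'v \<Rightarrow> 'v \<Rightarrow> bool" where
  "walk_le R n x y \<longleftrightarrow> (\<exists>m\<le>n. (x, y) \<in> R ^^ m)"

lemma walk_le_refl [simp]: "walk_le R n x x"
  unfolding walk_le_def by (intro exI[of _ 0]) simp

lemma walk_le_edge: "(x, y) \<in> R \<Longrightarrow> walk_le R 1 x y"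
  unfolding walk_le_def by (intro exI[of _ 1]) simp

lemma walk_le_mono: "walk_le R m x y \<Longrightarrow> m \<le> n \<Longrightarrow> walk_le R n x y"
  unfolding walk_le_def using le_trans by blast

lemma walk_le_trans: "walk_le R m x y \<Longrightarrow> walk_le R n y z \<Longrightarrow> walk_le R (m + n) x z"
  unfolding walk_le_def by (metis add_mono relcompI relpow_add)

text \<open>The common source of the walk transfers below: projecting to the walker, to one lamp or
  to cells, embedding walks of \<open>A\<close> or \<open>B\<close>, and overwriting a lamp all send
  an edge to an edge or to a single vertex.\<close>

lemma walk_le_map:
  assumes "walk_le R n x y" and "\<And>u v. (u, v) \<in> R \<Longrightarrow> F u = F v \<or> (F u, F v) \<in> R'"
  shows "walk_le R' n (F x) (F y)"
proof -
  have "walk_le R' m (F x) (F y)" if "(x, y) \<in> R ^^ m" for m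
    using that
  proof (induction m arbitrary: y)
    case (Suc m)
    then obtain z where z: "walk_le R' m (F x) (F z)" "(z, y) \<in> R"
      by auto
    have "walk_le R' 1 (F z) (F y)"
      using assms(2)[OF z(2)] walk_le_edge[of "F z" "F y" R'] by auto
    then show ?case
      using walk_le_trans[OF z(1)] by fastforce
  qed simp
  moreover obtain m where "m \<le> n" "(x, y) \<in> R ^^ m"
    using assms(1) unfolding walk_le_def by blast
  ultimately show ?thesis
    using walk_le_mono by metis
qed

lemma walk_le_sym:
  assumes "sym R" "walk_le R n x y"
  shows "walk_le R n y x"
proof -
  have "(y, x) \<in> R ^^ m" if "(x, y) \<in> R ^^ m" for m
    using that
  proof (induction m arbitrary: y)
    case (Suc m)
    then obtain z where "(z, x) \<in> R ^^ m" "(y, z) \<in> R"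
      using assms(1) by (auto dest: symD)
    then show ?case
      by (rule relpow_Suc_I2[rotated])
  qed simp
  then show ?thesis
    using assms(2) unfolding walk_le_def by blast
qed

lemma walk_le_rtrancl: "(x, y) \<in> R\<^sup>* \<Longrightarrow> \<exists>n. walk_le R n x y"
  unfolding walk_le_def by (auto simp: rtrancl_power)

lemma rtrancl_walk_le: "walk_le R n x y \<Longrightarrow> (x, y) \<in> R\<^sup>*"
  unfolding walk_le_def by (auto simp: rtrancl_power)

context
  fixes G :: "'v graph"
  assumes simple: "simple_graph G" and conn: "connected_graph G"
begin

lemma edges_in_verts: "(u, v) \<in> edges G \<Longrightarrow> u \<in> verts G" "(u, v) \<in> edges G \<Longrightarrow> v \<in> verts G"
  using edge_verts[OF simple conn] by auto

lemma sym_edges: "sym (edges G)"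
  using simple by (simp add: simple_graph_def)

lemma graph_dist_le_iff:
  assumes "u \<in> verts G" "v \<in> verts G"
  shows "graph_dist G u v \<le> n \<longleftrightarrow> walk_le (edges G) n u v"
  using graph_dist_walk[OF simple conn assms] graph_dist_le[OF simple conn, of u v]
  unfolding walk_le_def by (meson le_trans)

text \<open>Only finitely many vertices are reached in a given number of steps, so some vertex lies
  at distance at least \<open>n\<close>. The \<open>n\<close>-th vertex of a shortest walk to it has
  distance exactly \<open>n\<close>, as a smaller value would shorten that walk.\<close>

lemma ex_graph_dist_eq:
  assumes "locally_finite G" "infinite (verts G)" "k \<in> verts G"
  shows "\<exists>i\<in>verts G. graph_dist G k i = n"
proof -
  have reach: "v \<in> verts G" if "(k, v) \<in> edges G ^^ m" for v m
    using that assms(3) edges_in_verts by (cases m) auto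
  have fin: "finite {v. (k, v) \<in> edges G ^^ m}" for m
  proof (induction m)
    case (Suc m)
    have "{v. (k, v) \<in> edges G ^^ Suc m} \<subseteq>
        (\<Union>u\<in>{v. (k, v) \<in> edges G ^^ m}. {v. (u, v) \<in> edges G})"
      by auto
    moreover have "finite \<dots>"
      using Suc assms(1) reach by (intro finite_UN_I) (auto simp: locally_finite_def)
    ultimately show ?case
      by (rule finite_subset)
  qed simp
  have "finite (\<Union>m<n. {v. (k, v) \<in> edges G ^^ m})"
    using fin by simp
  then obtain v where v: "v \<in> verts G" "v \<notin> (\<Union>m<n. {v. (k, v) \<in> edges G ^^ m})"
    using assms(2) by (meson finite_subset subsetI)
  have walk: "(k, v) \<in> edges G ^^ graph_dist G k v"
    using graph_dist_walk[OF simple conn assms(3) v(1)] .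
  then have "n \<le> graph_dist G k v"
    using v(2) by force
  then obtain e where e: "graph_dist G k v = n + e"
    using le_Suc_ex by blast
  then obtain j where j: "(k, j) \<in> edges G ^^ n" "(j, v) \<in> edges G ^^ e"
    using walk by (auto simp: relpow_add)
  then have "j \<in> verts G"
    using reach by blast
  moreover have "graph_dist G k j \<le> n" "graph_dist G j v \<le> e"
    using graph_dist_le[OF simple conn] j by auto
  ultimately show ?thesis
    using graph_dist_triangle[OF simple conn assms(3) _ v(1), of j] e by (intro bexI[of _ j]) auto
qed

text \<open>By the triangle inequality, a walk of at most \<open>m\<close> steps cannot use up the
  margin \<open>m\<close> between its start and the ball.\<close>

lemma walk_avoids_ball:
  assumes "c \<in> verts G" "x \<in> verts G" "y \<in> verts G" "walk_le (edges G) m x y"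
    and "N + m \<le> graph_dist G c x"
  shows "walk_le (Restr (edges G) {v. N \<le> graph_dist G c v}) m x y"
proof -
  have "(x, y) \<in> (Restr (edges G) {v. N \<le> graph_dist G c v}) ^^ k"
    if "(x, y) \<in> edges G ^^ k" "k \<le> m" "y \<in> verts G" for k
    using that
  proof (induction k arbitrary: y)
    case (Suc k)
    then obtain z where z: "(x, z) \<in> edges G ^^ k" "(z, y) \<in> edges G"
      by auto
    have V: "z \<in> verts G"
      using z edges_in_verts by auto
    have far: "N \<le> graph_dist G c w" if "(x, w) \<in> edges G ^^ j" "j \<le> m" "w \<in> verts G" for w j
    proof -
      have "graph_dist G w x \<le> j"
        using graph_dist_le[OF simple conn that(1)] graph_dist_sym[OF simple conn assms(2) that(3)]
        by simp
      then show ?thesis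
        using graph_dist_triangle[OF simple conn assms(1) that(3) assms(2)] assms(5) that(2) by linarith
    qed
    have "(z, y) \<in> Restr (edges G) {v. N \<le> graph_dist G c v}"
      using far[OF z(1)] far[OF Suc.prems(1)] Suc.prems V z by auto
    then show ?case
      using Suc.IH[OF z(1)] Suc.prems(2) V by auto
  qed simp
  then show ?thesis
    using assms(3,4) unfolding walk_le_def by blast
qed

end


section \<open>Detours in the wreath product\<close>

locale wreath =
  fixes A :: "'a graph" and B :: "'b graph" and I :: "'i set" and P :: "'i \<Rightarrow> 'a set" and b\<^sub>0 :: 'b
  assumes A: "simple_graph A" "connected_graph A"
    and B: "simple_graph B" "connected_graph B"
    and b\<^sub>0: "b\<^sub>0 \<in> verts B"
    and part: "partitions I P (verts A)"
begin

section \<open>Vertices, edges and connectedness of the wreath product\<close>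

abbreviation W :: "(('i \<Rightarrow> 'b) \<times> 'a) graph" where
  "W \<equiv> wreath_product B b\<^sub>0 A I P"

abbreviation Q :: "'i graph" where
  "Q \<equiv> quotient_graph A I P"

definition configs :: "('i \<Rightarrow> 'b) set" where
  "configs = {f \<in> I \<rightarrow>\<^sub>E verts B. finite {i \<in> I. f i \<noteq> b\<^sub>0}}"

lemma verts_W: "verts W = configs \<times> verts A"
  by (simp add: wreath_product_def wreath_verts_def configs_def)

lemma verts_Q: "verts Q = I"
  by (simp add: quotient_graph_def)

lemma config_verts: "f \<in> configs \<Longrightarrow> i \<in> I \<Longrightarrow> f i \<in> verts B"
  by (auto simp: configs_def)

lemma config_eqI: "f \<in> configs \<Longrightarrow> g \<in> configs \<Longrightarrow> (\<And>i. i \<in> I \<Longrightarrow> f i = g i) \<Longrightarrow> f = g"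
  unfolding configs_def by (blast intro: PiE_ext)

lemma config_upd:
  assumes "f \<in> configs" "i \<in> I" "s \<in> verts B"
  shows "f(i := s) \<in> configs"
proof -
  have "{j \<in> I. (f(i := s)) j \<noteq> b\<^sub>0} \<subseteq> insert i {j \<in> I. f j \<noteq> b\<^sub>0}"
    by auto
  moreover have "finite (insert i {j \<in> I. f j \<noteq> b\<^sub>0})"
    using assms(1) by (simp add: configs_def)
  ultimately have "finite {j \<in> I. (f(i := s)) j \<noteq> b\<^sub>0}"
    by (rule finite_subset)
  moreover have "f(i := s) \<in> I \<rightarrow>\<^sub>E verts B"
    using assms by (auto simp: configs_def PiE_def extensional_def)
  ultimately show ?thesis
    by (simp add: configs_def)
qed

lemma part_verts: "i \<in> I \<Longrightarrow> p \<in> P i \<Longrightarrow> p \<in> verts A"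
  using part by (auto simp: partitions_def)

lemma part_nonempty: "i \<in> I \<Longrightarrow> P i \<noteq> {}"
  using part by (auto simp: partitions_def)

lemma part_ex: "a \<in> verts A \<Longrightarrow> \<exists>i\<in>I. a \<in> P i"
  using part by (auto simp: partitions_def)

lemma part_unique: "i \<in> I \<Longrightarrow> j \<in> I \<Longrightarrow> a \<in> P i \<Longrightarrow> a \<in> P j \<Longrightarrow> i = j"
  using part by (auto simp: partitions_def disjoint_family_on_def)

definition cell :: "'a \<Rightarrow> 'i" where
  "cell a = (THE i. i \<in> I \<and> a \<in> P i)"

lemma cell_eq: "i \<in> I \<Longrightarrow> a \<in> P i \<Longrightarrow> cell a = i"
  unfolding cell_def using part_unique by blast

lemma cell_in: "a \<in> verts A \<Longrightarrow> cell a \<in> I" "a \<in> verts A \<Longrightarrow> a \<in> P (cell a)"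
  using part_ex cell_eq by metis+

lemma cell_edge:
  assumes "(a, a') \<in> edges A"
  shows "cell a = cell a' \<or> (cell a, cell a') \<in> edges Q"
  using cell_in[of a] cell_in[of a'] edges_in_verts[OF A assms] assms
  by (auto simp: quotient_graph_def)

lemma edge_W_iff:
  "((f, a), (g, b)) \<in> edges W \<longleftrightarrow> f \<in> configs \<and> g \<in> configs \<and> a \<in> verts A \<and> b \<in> verts A \<and>
     (a = b \<and> (\<exists>j\<in>I. a \<in> P j \<and> (\<forall>i\<in>I - {j}. f i = g i) \<and> (f j, g j) \<in> edges B) \<or>
      f = g \<and> (a, b) \<in> edges A)"
  by (auto simp: wreath_product_def wreath_verts_def configs_def)

lemma move_edge:
  "f \<in> configs \<Longrightarrow> (a, b) \<in> edges A \<Longrightarrow> ((f, a), (f, b)) \<in> edges W"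
  using edges_in_verts[OF A] by (auto simp: edge_W_iff)

lemma switch_edge:
  assumes "f \<in> configs" "i \<in> I" "a \<in> P i" "(s, t) \<in> edges B"
  shows "((f(i := s), a), (f(i := t), a)) \<in> edges W"
  using config_upd[OF assms(1,2)] edges_in_verts[OF B assms(4)] part_verts assms
  by (auto simp: edge_W_iff)

text \<open>Puts a lamp edge into the form of a function update. This is an equality of functions,
  not only on \<open>I\<close>, because configurations are extensional.\<close>

lemma edge_W_cases:
  assumes "(x, y) \<in> edges W"
  obtains (move) f a b where "x = (f, a)" "y = (f, b)" "f \<in> configs" "(a, b) \<in> edges A"
  | (switch) f a i t where "x = (f, a)" "y = (f(i := t), a)" "f \<in> configs" "i \<in> I" "a \<in> P i"
      "(f i, t) \<in> edges B"
proof -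
  obtain f a g b where xy: "x = (f, a)" "y = (g, b)"
    by fastforce
  note e = assms[unfolded xy edge_W_iff]
  show thesis
  proof (cases "f = g \<and> (a, b) \<in> edges A")
    case True
    then show ?thesis
      using e move xy by blast
  next
    case False
    then obtain j where j: "a = b" "j \<in> I" "a \<in> P j" "\<forall>i\<in>I - {j}. f i = g i" "(f j, g j) \<in> edges B"
      using e by blast
    have "g = f(j := g j)"
      using e j by (intro config_eqI) (auto intro: config_upd config_verts)
    then show ?thesis
      using switch[of f a j "g j"] xy j e by simp
  qed
qed

lemma simple_W: "simple_graph W"
  unfolding simple_graph_def
proof (intro conjI)
  show "edges W \<subseteq> verts W \<times> verts W"
    by (auto simp: wreath_product_def)
  show "sym (edges W)"
  proof (rule symI, clarify)
    fix f a g b assume "((f, a), (g, b)) \<in> edges W"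
    then show "((g, b), (f, a)) \<in> edges W"
    proof (cases rule: edge_W_cases)
      case (move h p q)
      then show ?thesis
        using sym_edges[OF A] by (auto intro: move_edge dest: symD)
    next
      case (switch h p i t)
      then have "(t, h i) \<in> edges B"
        using sym_edges[OF B] by (auto dest: symD)
      then show ?thesis
        using switch switch_edge[of h i p t "h i"] by simp
    qed
  qed
  show "irrefl (edges W)"
    using A(1) B(1) by (auto simp: irrefl_def edge_W_iff simple_graph_def)
qed

lemma walk_move:
  "f \<in> configs \<Longrightarrow> walk_le (edges A) n a b \<Longrightarrow> walk_le (edges W) n (f, a) (f, b)"
  by (erule walk_le_map[where F = "Pair f"]) (blast intro: move_edge)

lemma walk_switch:
  "f \<in> configs \<Longrightarrow> i \<in> I \<Longrightarrow> a \<in> P i \<Longrightarrow> walk_le (edges B) n s t \<Longrightarrow>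
   walk_le (edges W) n (f(i := s), a) (f(i := t), a)"
  by (erule walk_le_map[where F = "\<lambda>s. (f(i := s), a)"]) (blast intro: switch_edge)

lemma walk_A:
  assumes "a \<in> verts A" "b \<in> verts A"
  obtains n where "walk_le (edges A) n a b"
  using A(2) assms walk_le_rtrancl[of a b "edges A"] by (auto simp: connected_graph_def)

lemma walk_B:
  assumes "s \<in> verts B" "t \<in> verts B"
  obtains n where "walk_le (edges B) n s t"
  using B(2) assms walk_le_rtrancl[of s t "edges B"] by (auto simp: connected_graph_def)

text \<open>One lamp is changed by walking to its cell, switching there and walking back. Two
  configurations differ in finitely many lamps, so an induction over these lamps joins them.\<close>

lemma connected_W: "connected_graph W"
proof -
  have move: "((f, a), (f, b)) \<in> (edges W)\<^sup>*" if "f \<in> configs" "a \<in> verts A" "b \<in> verts A" for f a b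
    using walk_A[OF that(2,3)] walk_move[OF that(1)] rtrancl_walk_le by metis
  have switch: "((f, a), (f(i := t), a)) \<in> (edges W)\<^sup>*"
    if "f \<in> configs" "i \<in> I" "t \<in> verts B" "a \<in> verts A" for f a i t
  proof -
    obtain p where p: "p \<in> P i" "p \<in> verts A"
      using part_nonempty part_verts \<open>i \<in> I\<close> by blast
    obtain n where "walk_le (edges B) n (f i) t"
      using walk_B config_verts \<open>f \<in> configs\<close> \<open>i \<in> I\<close> \<open>t \<in> verts B\<close> by metis
    then have "((f, p), (f(i := t), p)) \<in> (edges W)\<^sup>*"
      using walk_switch[OF that(1,2) p(1)] rtrancl_walk_le fun_upd_triv by metis
    then show ?thesis
      by (rule rtrancl_trans[OF move[OF that(1,4) p(2)]
          rtrancl_trans[OF _ move[OF config_upd[OF that(1-3)] p(2) that(4)]]])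
  qed
  have conn: "((f, a), (g, a)) \<in> (edges W)\<^sup>*"
    if "finite D" "{i \<in> I. f i \<noteq> g i} = D" "f \<in> configs" "g \<in> configs" "a \<in> verts A" for f g a D
    using that
  proof (induction D arbitrary: f rule: finite_induct)
    case empty
    then show ?case
      using config_eqI[of f g] by auto
  next
    case (insert i D)
    then have i: "i \<in> I" "g i \<in> verts B"
      using config_verts by auto
    have "((f(i := g i), a), (g, a)) \<in> (edges W)\<^sup>*"
    proof (rule insert.IH[OF _ config_upd[OF insert.prems(2) i] insert.prems(3,4)])
      show "{j \<in> I. (f(i := g i)) j \<noteq> g j} = D"
        using insert.prems(1) insert.hyps(2) by auto
    qed
    then show ?case
      by (rule rtrancl_trans[OF switch[OF insert.prems(2) i insert.prems(4)]])
  qed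
  have "((f, a), (g, b)) \<in> (edges W)\<^sup>*"
    if "f \<in> configs" "g \<in> configs" "a \<in> verts A" "b \<in> verts A" for f g a b
  proof -
    have "{i \<in> I. f i \<noteq> g i} \<subseteq> {i \<in> I. f i \<noteq> b\<^sub>0} \<union> {i \<in> I. g i \<noteq> b\<^sub>0}"
      by auto
    then have "finite {i \<in> I. f i \<noteq> g i}"
      using that(1,2) unfolding configs_def mem_Collect_eq by (meson finite_UnI finite_subset)
    then show ?thesis
      by (rule rtrancl_trans[OF conn[OF _ refl that(1,2,3)] move[OF that(2,3,4)]])
  qed
  then show ?thesis
    by (auto simp: connected_graph_def verts_W)
qed

section \<open>Projections of walks\<close>

lemma walk_position:
  "walk_le (edges W) n x y \<Longrightarrow> walk_le (edges A) n (snd x) (snd y)"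
  by (erule walk_le_map[where F = snd]) (auto elim!: edge_W_cases)

lemma walk_lamp:
  "walk_le (edges W) n x y \<Longrightarrow> walk_le (edges B) n (fst x i) (fst y i)"
  by (erule walk_le_map[where F = "\<lambda>x. fst x i"]) (auto elim!: edge_W_cases)

text \<open>A lamp changes only while the walker stands in its cell, so the first step that changes
  lamp \<open>i\<close> shows the walker inside \<open>P i\<close>.\<close>

lemma walk_visits_switched:
  assumes "walk_le (edges W) n x y" "fst x i \<noteq> fst y i"
  shows "\<exists>p\<in>P i. walk_le (edges A) n (snd x) p"
proof -
  have "\<exists>p\<in>P i. walk_le (edges A) m (snd x) p" if "(x, y) \<in> edges W ^^ m" "fst x i \<noteq> fst y i" for m
    using that
  proof (induction m arbitrary: x)
    case (Suc m)
    obtain z where z: "(x, z) \<in> edges W" "(z, y) \<in> edges W ^^ m"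
      using relpow_Suc_D2[OF Suc.prems(1)] by blast
    show ?case
    proof (cases "fst x i = fst z i")
      case True
      then obtain p where p: "p \<in> P i" "walk_le (edges A) m (snd z) p"
        using Suc.IH[OF z(2)] Suc.prems(2) by auto
      have "walk_le (edges A) 1 (snd x) (snd z)"
        using walk_position[OF walk_le_edge[OF z(1)]] .
      then show ?thesis
        using walk_le_trans[OF _ p(2)] p(1) by fastforce
    next
      case False
      then have "snd x \<in> P i"
        using z(1) by (auto elim!: edge_W_cases split: if_splits)
      then show ?thesis
        by (intro bexI[of _ "snd x"]) simp_all
    qed
  qed simp
  moreover obtain m where "m \<le> n" "(x, y) \<in> edges W ^^ m"
    using assms(1) unfolding walk_le_def by blast
  ultimately show ?thesis
    using assms(2) walk_le_mono by metis
qed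

section \<open>Walks that stay outside a ball\<close>

definition far :: "'a \<Rightarrow> nat \<Rightarrow> 'i set" where
  "far c N = {i \<in> I. \<forall>p\<in>P i. N \<le> graph_dist A c p}"

text \<open>There is no intersection with \<open>verts W\<close>: the set serves to restrict
  \<open>edges W\<close>, whose endpoints are vertices anyway.\<close>

definition outside :: "('i \<Rightarrow> 'b) \<times> 'a \<Rightarrow> nat \<Rightarrow> (('i \<Rightarrow> 'b) \<times> 'a) set" where
  "outside c N = {x. N \<le> graph_dist W c x}"

text \<open>Projecting a walk to the walker does not lengthen it, so distances in \<open>W\<close>
  dominate those in \<open>A\<close>.\<close>

lemma outside_position:
  assumes "c \<in> verts W" "f \<in> configs" "i \<in> far (snd c) N" "p \<in> P i"
  shows "(f, p) \<in> outside c N"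
proof -
  have V: "(f, p) \<in> verts W" "snd c \<in> verts A" "p \<in> verts A"
    using assms part_verts by (auto simp: verts_W far_def)
  have "walk_le (edges W) (graph_dist W c (f, p)) c (f, p)"
    using graph_dist_le_iff[OF simple_W connected_W assms(1) V(1)] by blast
  then have "walk_le (edges A) (graph_dist W c (f, p)) (snd c) p"
    using walk_position by fastforce
  then have "graph_dist A (snd c) p \<le> graph_dist W c (f, p)"
    using graph_dist_le_iff[OF A V(2,3)] by blast
  then show ?thesis
    using assms(3,4) le_trans unfolding far_def outside_def by blast
qed

text \<open>Every walk from \<open>c\<close> that changes lamp \<open>i\<close> has to carry the
  walker into \<open>P i\<close>, which already costs \<open>N\<close> steps.\<close>

lemma outside_lamp:
  assumes "c \<in> verts W" "(f, a) \<in> verts W" "i \<in> far (snd c) N" "f i \<noteq> fst c i"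
  shows "(f, a) \<in> outside c N"
proof -
  have walk: "walk_le (edges W) (graph_dist W c (f, a)) c (f, a)"
    using graph_dist_le_iff[OF simple_W connected_W assms(1,2)] by blast
  have "fst c i \<noteq> fst (f, a) i"
    using assms(4) by simp
  then obtain p where p: "p \<in> P i" "walk_le (edges A) (graph_dist W c (f, a)) (snd c) p"
    using walk_visits_switched[OF walk] by blast
  moreover have "snd c \<in> verts A" "p \<in> verts A"
    using assms p part_verts by (auto simp: verts_W far_def)
  ultimately have "graph_dist A (snd c) p \<le> graph_dist W c (f, a)"
    using graph_dist_le_iff[OF A] by blast
  then show ?thesis
    using assms(3) p(1) le_trans unfolding far_def outside_def by blast
qed

lemma outside_walk_move:
  assumes "c \<in> verts W" "f \<in> configs" "i \<in> far (snd c) N" "f i \<noteq> fst c i"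
    and "walk_le (edges A) n a b"
  shows "walk_le (Restr (edges W) (outside c N)) n (f, a) (f, b)"
  using assms(5)
proof (rule walk_le_map[where F = "Pair f"])
  fix u v assume e: "(u, v) \<in> edges A"
  then have "(f, u) \<in> verts W" "(f, v) \<in> verts W"
    using assms(2) edges_in_verts[OF A] by (auto simp: verts_W)
  then show "(f, u) = (f, v) \<or> ((f, u), (f, v)) \<in> Restr (edges W) (outside c N)"
    using move_edge[OF assms(2) e] outside_lamp[OF assms(1) _ assms(3), of f u]
      outside_lamp[OF assms(1) _ assms(3), of f v] assms(4) by blast
qed

lemma outside_walk_switch:
  assumes "c \<in> verts W" "f \<in> configs" "i \<in> far (snd c) N" "p \<in> P i"
    and "walk_le (edges B) n s t"
  shows "walk_le (Restr (edges W) (outside c N)) n (f(i := s), p) (f(i := t), p)"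
  using assms(5)
proof (rule walk_le_map[where F = "\<lambda>s. (f(i := s), p)"])
  fix u v assume e: "(u, v) \<in> edges B"
  have i: "i \<in> I"
    using assms(3) by (simp add: far_def)
  have "(f(i := w), p) \<in> outside c N" if "w \<in> verts B" for w
    using outside_position[OF assms(1) config_upd[OF assms(2) i that] assms(3,4)] .
  then show "(f(i := u), p) = (f(i := v), p) \<or>
      ((f(i := u), p), (f(i := v), p)) \<in> Restr (edges W) (outside c N)"
    using switch_edge[OF assms(2) i assms(4) e] edges_in_verts[OF B e] by blast
qed

text \<open>Overwriting lamp \<open>i\<close> by \<open>s\<close> preserves edges, except that
  switches of lamp \<open>i\<close> collapse to a point. In the image lamp \<open>i\<close> always
  differs from the centre, so the given walk itself may pass through the ball.\<close>

lemma outside_walk_frozen: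
  assumes "c \<in> verts W" "i \<in> far (snd c) N" "s \<in> verts B" "s \<noteq> fst c i"
    and "walk_le (edges W) n (f, a) (g, b)"
  shows "walk_le (Restr (edges W) (outside c N)) n (f(i := s), a) (g(i := s), b)"
proof -
  let ?F = "\<lambda>x. ((fst x)(i := s), snd x)"
  have i: "i \<in> I"
    using assms(2) by (simp add: far_def)
  have "walk_le (Restr (edges W) (outside c N)) n (?F (f, a)) (?F (g, b))"
    using assms(5)
  proof (rule walk_le_map[where F = ?F])
    fix x y assume e: "(x, y) \<in> edges W"
    have V: "?F w \<in> verts W" if "w \<in> verts W" for w
      using that config_upd[OF _ i assms(3)] by (auto simp: verts_W)
    have out: "?F w \<in> outside c N" if "w \<in> verts W" for w
      using outside_lamp[OF assms(1) V[OF that] assms(2)] assms(4) by simp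
    have xy: "x \<in> verts W" "y \<in> verts W"
      using e edges_in_verts[OF simple_W connected_W] by blast+
    have "?F x = ?F y \<or> (?F x, ?F y) \<in> edges W"
      using e
    proof (cases rule: edge_W_cases)
      case (move f a b)
      then show ?thesis
        using move_edge[OF config_upd[OF _ i assms(3)]] by simp
    next
      case (switch f a j t)
      show ?thesis
      proof (cases "j = i")
        case False
        then show ?thesis
          using switch switch_edge[OF config_upd[OF switch(3) i assms(3)] switch(4,5,6)]
          by (simp add: fun_upd_twist fun_upd_idem)
      qed (use switch in simp)
    qed
    then show "?F x = ?F y \<or> (?F x, ?F y) \<in> Restr (edges W) (outside c N)"
      using out[OF xy(1)] out[OF xy(2)] by blast
  qed
  then show ?thesis
    by simp
qed


text \<open>Yields a lamp value other than that of the centre, at most one switch away: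
  \<open>t\<close> itself, or a neighbour of \<open>t\<close>, which exists because \<open>B\<close>
  is connected with two vertices.\<close>

lemma ex_other_vertex:
  assumes "\<exists>u\<in>verts B. \<exists>v\<in>verts B. u \<noteq> v" "t \<in> verts B"
  shows "\<exists>s\<in>verts B. s \<noteq> u \<and> walk_le (edges B) 1 t s"
proof (cases "t = u")
  case True
  obtain v where v: "v \<in> verts B" "v \<noteq> t"
    using assms(1) by metis
  then have "(t, v) \<in> (edges B)\<^sup>*"
    using B(2) assms(2) by (auto simp: connected_graph_def)
  then obtain s where s: "(t, s) \<in> edges B"
    using v(2) by (auto elim: converse_rtranclE)
  then show ?thesis
    using True edge_verts[OF B s] walk_le_edge[OF s] by (intro bexI[of _ s]) auto
next
  case False
  then show ?thesis
    using assms(2) by (intro bexI[of _ t]) auto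
qed

text \<open>
  While a far lamp differs from its value at the centre, the walker may roam freely. The lamps over
  the cells of the two endpoints are set to such values alternately, so that at any time one of them
  protects the walk.
\<close>

lemma far_cells_joined:
  assumes two: "\<exists>u\<in>verts B. \<exists>v\<in>verts B. u \<noteq> v"
    and c: "c \<in> verts W" and f: "f \<in> configs" and g: "g \<in> configs"
    and i: "i \<in> far (snd c) N" and p: "p \<in> P i"
    and j: "j \<in> far (snd c) N" and q: "q \<in> P j"
    and walk: "walk_le (edges W) D (f, p) (g, q)"
  shows "walk_le (Restr (edges W) (outside c N)) (4 * D + 4) (f, p) (g, q)"
proof -
  let ?R = "Restr (edges W) (outside c N)"
  have I: "i \<in> I" "j \<in> I"
    using i j by (auto simp: far_def)
  obtain s where s: "s \<in> verts B" "s \<noteq> fst c i" "walk_le (edges B) 1 (f i) s"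
    using ex_other_vertex[OF two config_verts[OF f I(1)]] by blast
  have "walk_le (edges B) D (f i) (g i)"
    using walk_lamp[OF walk] by simp
  \<comment> \<open>Prepares the reset of lamp \<open>i\<close>: go back from \<open>s\<close> to
    \<open>f i\<close>, then follow what the given walk does to this lamp.\<close>
  then have sg: "walk_le (edges B) (1 + D) s (g i)"
    by (rule walk_le_trans[OF walk_le_sym[OF sym_edges[OF B] s(3)]])
  \<comment> \<open>The walker sets lamp \<open>i\<close> to \<open>s\<close> inside its far cell
    and then copies the given walk with this lamp frozen.\<close>
  have "walk_le ?R 1 (f, p) (f(i := s), p)"
    using outside_walk_switch[OF c f i p s(3)] by simp
  from walk_le_trans[OF this outside_walk_frozen[OF c i s(1,2) walk]]
  have start: "walk_le ?R (1 + D) (f, p) (g(i := s), q)" .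
  show ?thesis
  proof (cases "i = j")
    case True
    have "walk_le ?R (1 + D) (g(i := s), q) (g, q)"
      using outside_walk_switch[OF c g i _ sg, of q] q True by simp
    from walk_le_trans[OF start this] show ?thesis
      by (rule walk_le_mono) simp
  next
    case False
    \<comment> \<open>Lamp \<open>i\<close> can be reset only inside \<open>P i\<close>, so the
      walker must return to \<open>p\<close>. Lamp \<open>j\<close> is set to \<open>t\<close>
      first: lamp \<open>i\<close> protects the way from \<open>q\<close> to \<open>p\<close>, and
      after its reset lamp \<open>j\<close> protects the way back.\<close>
    obtain t where t: "t \<in> verts B" "t \<noteq> fst c j" "walk_le (edges B) 1 (g j) t"
      using ex_other_vertex[OF two config_verts[OF g I(2)]] by blast
    have gt: "g(j := t) \<in> configs" and gs: "g(i := s) \<in> configs"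
      using config_upd g I s(1) t(1) by auto
    then have gst: "g(i := s, j := t) \<in> configs"
      using config_upd I t(1) by auto
    have pq: "walk_le (edges A) D p q"
      using walk_position[OF walk] by simp
    have "walk_le ?R 1 (g(i := s), q) (g(i := s, j := t), q)"
      using outside_walk_switch[OF c gs j q, of 1 "g j" t] t(3) False by (simp add: fun_upd_idem)
    note r = walk_le_trans[OF start this]
    have "walk_le ?R D (g(i := s, j := t), q) (g(i := s, j := t), p)"
      by (rule outside_walk_move[OF c gst i _ walk_le_sym[OF sym_edges[OF A] pq]])
        (use s(2) False in simp)
    note r = walk_le_trans[OF r this]
    have "walk_le ?R (1 + D) (g(i := s, j := t), p) (g(j := t), p)"
      using outside_walk_switch[OF c gt i p sg] False by (simp add: fun_upd_twist fun_upd_idem)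
    note r = walk_le_trans[OF r this]
    have "walk_le ?R D (g(j := t), p) (g(j := t), q)"
      by (rule outside_walk_move[OF c gt j _ pq]) (use t(2) in simp)
    note r = walk_le_trans[OF r this]
    have "walk_le ?R 1 (g(j := t), q) (g, q)"
      using outside_walk_switch[OF c g j q walk_le_sym[OF sym_edges[OF B] t(3)]] by simp
    \<comment> \<open>The stages cost \<open>1 + D\<close>, \<open>1\<close>, \<open>D\<close>,
      \<open>1 + D\<close>, \<open>D\<close> and \<open>1\<close>, in total
      \<open>4 * D + 4\<close>.\<close>
    from walk_le_trans[OF r this] show ?thesis
      by (rule walk_le_mono) simp
  qed
qed

section \<open>Reaching far cells through the quotient graph\<close>

lemma simple_Q: "simple_graph Q"
proof -
  have "(j, i) \<in> edges Q" if "(i, j) \<in> edges Q" for i j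
    using that sym_edges[OF A] unfolding quotient_graph_def by (auto dest: symD)
  then have "sym (edges Q)"
    by (rule symI)
  then show ?thesis
    by (auto simp: simple_graph_def quotient_graph_def irrefl_def)
qed

lemma walk_cell: "walk_le (edges A) n a b \<Longrightarrow> walk_le (edges Q) n (cell a) (cell b)"
  by (erule walk_le_map[where F = cell]) (rule cell_edge)

lemma connected_Q: "connected_graph Q"
  unfolding connected_graph_def verts_Q
proof (intro ballI)
  fix i j assume I: "i \<in> I" "j \<in> I"
  then obtain p q where pq: "p \<in> P i" "q \<in> P j"
    using part_nonempty by blast
  then obtain n where "walk_le (edges A) n p q"
    using walk_A I part_verts by metis
  then show "(i, j) \<in> (edges Q)\<^sup>*"
    using rtrancl_walk_le[OF walk_cell] cell_eq I pq by metis
qed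

text \<open>Allows a cell to be recognised as far by its distance in \<open>Q\<close> alone.\<close>

lemma graph_dist_cell:
  assumes "a \<in> verts A" "b \<in> verts A"
  shows "graph_dist Q (cell a) (cell b) \<le> graph_dist A a b"
proof -
  have "walk_le (edges A) (graph_dist A a b) a b"
    using graph_dist_le_iff[OF A assms] by blast
  moreover have "cell a \<in> verts Q" "cell b \<in> verts Q"
    using cell_in assms by (auto simp: verts_Q)
  ultimately show ?thesis
    using walk_cell graph_dist_le_iff[OF simple_Q connected_Q] by blast
qed

text \<open>Edges are the pairs at distance one; injectivity excludes distance zero for the
  images.\<close>

lemma graph_isometry_edge:
  assumes "graph_isometry A \<phi>" "(u, v) \<in> edges A"
  shows "(\<phi> u, \<phi> v) \<in> edges A"
proof -
  have uv: "u \<in> verts A" "v \<in> verts A" "u \<noteq> v"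
    using edge_verts[OF A assms(2)] by auto
  then have im: "\<phi> u \<in> verts A" "\<phi> v \<in> verts A" "\<phi> u \<noteq> \<phi> v"
    using assms(1) by (auto simp: graph_isometry_def bij_betw_def inj_on_def)
  have "graph_dist A (\<phi> u) (\<phi> v) \<le> 1"
    using graph_dist_edge[OF A assms(2)] assms(1) uv by (auto simp: graph_isometry_def)
  moreover have "graph_dist A (\<phi> u) (\<phi> v) \<noteq> 0"
    using graph_dist_eq_0[OF A im(1,2)] im(3) by blast
  ultimately have "graph_dist A (\<phi> u) (\<phi> v) = 1"
    by simp
  then show ?thesis
    using graph_dist_walk[OF A im(1,2)] by simp
qed

text \<open>
  The isometries of the family carry the finitely many cells adjacent to the cell of one base vertex
  to the cells adjacent to the cell of any other vertex.
\<close>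

lemma ex_uniform_cell_gap:
  assumes trans: "transitive_family A I P" and fin: "locally_finite Q"
  shows "\<exists>M. \<forall>a\<in>verts A. \<forall>j. (cell a, j) \<in> edges Q \<longrightarrow> (\<exists>p\<in>P j. graph_dist A a p \<le> M)"
proof (cases "verts A = {}")
  case False
  then obtain o' where o': "o' \<in> verts A"
    by blast
  let ?J = "{j. (cell o', j) \<in> edges Q}"
  \<comment> \<open>Any point of an adjacent cell may represent it, as only an upper bound over
    finitely many cells is wanted. If \<open>?J\<close> is empty, the maximum below is unspecified
    but there is no adjacent cell to bound.\<close>
  define m where "m j = graph_dist A o' (SOME p. p \<in> P j)" for j
  have J: "finite ?J" "?J \<subseteq> I"
    using fin cell_in[OF o'] by (auto simp: locally_finite_def verts_Q quotient_graph_def)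
  have m: "\<exists>p\<in>P j. graph_dist A o' p \<le> Max (m ` ?J)" if "j \<in> ?J" for j
  proof (rule bexI)
    show "(SOME p. p \<in> P j) \<in> P j"
      using part_nonempty[of j] that J by (intro some_in_eq[THEN iffD2]) auto
    show "graph_dist A o' (SOME p. p \<in> P j) \<le> Max (m ` ?J)"
      using J that by (auto simp: m_def intro: Max_ge)
  qed
  have "\<exists>p\<in>P j. graph_dist A a p \<le> Max (m ` ?J)" if a: "a \<in> verts A" and j: "(cell a, j) \<in> edges Q" for a j
  proof -
    \<comment> \<open>The isometry leads from \<open>a\<close> to the base vertex, so the bound
      found there is pulled back along it.\<close>
    obtain \<phi> where \<phi>: "graph_isometry A \<phi>" "\<forall>i\<in>I. \<exists>k\<in>I. \<phi> ` P i = P k" "\<phi> a = o'"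
      using trans a o' unfolding transitive_family_def by blast
    have inj: "inj_on \<phi> (verts A)"
      using \<phi>(1) by (simp add: graph_isometry_def bij_betw_def)
    obtain u v where uv: "cell a \<in> I" "j \<in> I" "cell a \<noteq> j" "u \<in> P (cell a)" "v \<in> P j" "(u, v) \<in> edges A"
      using j by (auto simp: quotient_graph_def)
    obtain i' j' where ij: "i' \<in> I" "\<phi> ` P (cell a) = P i'" "j' \<in> I" "\<phi> ` P j = P j'"
      using \<phi>(2) uv by metis
    have "i' = cell o'"
      using cell_eq[OF ij(1), of o'] ij(2) \<phi>(3) cell_in(2)[OF a] by auto
    \<comment> \<open>\<open>Q\<close> has no loops, so the image cells must be distinct to be
      adjacent; injectivity of \<phi> ensures this.\<close>
    moreover have "i' \<noteq> j'"
    proof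
      assume "i' = j'"
      then have "\<phi> a \<in> \<phi> ` P j"
        using ij(2,4) cell_in(2)[OF a] by blast
      then obtain w where "w \<in> P j" "\<phi> w = \<phi> a"
        by (metis imageE)
      then have "a \<in> P j"
        using inj_onD[OF inj] a uv(2) part_verts by metis
      then show False
        using cell_eq uv(2,3) by blast
    qed
    moreover have "\<phi> u \<in> P i'" "\<phi> v \<in> P j'" "(\<phi> u, \<phi> v) \<in> edges A"
      using ij uv graph_isometry_edge[OF \<phi>(1)] by auto
    ultimately have "j' \<in> ?J"
      using ij by (auto simp: quotient_graph_def)
    then obtain p' where p': "p' \<in> \<phi> ` P j" "graph_dist A o' p' \<le> Max (m ` ?J)"
      using m ij(4) by blast
    then obtain p where "p \<in> P j" "p' = \<phi> p"
      by blast
    then have p: "p \<in> P j" "graph_dist A (\<phi> a) (\<phi> p) \<le> Max (m ` ?J)"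
      using p'(2) \<phi>(3) by simp_all
    then have "graph_dist A a p \<le> Max (m ` ?J)"
      using \<phi>(1) a part_verts[OF uv(2)] by (auto simp: graph_isometry_def)
    then show ?thesis
      using p(1) by blast
  qed
  then show ?thesis
    by blast
qed simp

lemma ex_far_cell_near:
  assumes trans: "transitive_family A I P" and fin: "locally_finite Q" and inf: "infinite I"
  shows "\<exists>M. \<forall>a\<in>verts A. \<forall>c\<in>verts A. \<forall>N. \<exists>i\<in>far c N. \<exists>p\<in>P i. walk_le (edges A) (M * N) a p"
proof -
  obtain M where M: "\<exists>p\<in>P j. graph_dist A a p \<le> M" if "a \<in> verts A" "(cell a, j) \<in> edges Q" for a j
    using ex_uniform_cell_gap[OF trans fin] by blast
  \<comment> \<open>The gap bound holds from every point of a cell, so the walker can continue from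
    wherever it entered the previous cell.\<close>
  have near: "\<exists>p\<in>P j. graph_dist A a p \<le> M * n"
    if a: "a \<in> verts A" and n: "(cell a, j) \<in> edges Q ^^ n" for a j n
    using n
  proof (induction n arbitrary: j)
    case 0
    then show ?case
      using cell_in(2)[OF a] graph_dist_refl[OF A] by (intro bexI[of _ a]) auto
  next
    case (Suc n)
    then obtain k where k: "(cell a, k) \<in> edges Q ^^ n" "(k, j) \<in> edges Q"
      by auto
    then have kj: "k \<in> I" "j \<in> I"
      by (auto simp: quotient_graph_def)
    obtain p where p: "p \<in> P k" "graph_dist A a p \<le> M * n"
      using Suc.IH[OF k(1)] by blast
    then have pv: "p \<in> verts A" "cell p = k"
      using part_verts cell_eq kj by auto
    then obtain p' where p': "p' \<in> P j" "graph_dist A p p' \<le> M"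
      using M k(2) by blast
    then have "graph_dist A a p' \<le> graph_dist A a p + graph_dist A p p'"
      using graph_dist_triangle[OF A a pv(1)] part_verts kj by blast
    then show ?case
      using p p' by (intro bexI[of _ p']) auto
  qed
  have "\<exists>i\<in>far c N. \<exists>p\<in>P i. walk_le (edges A) (2 * M * N) a p"
    if a: "a \<in> verts A" and c: "c \<in> verts A" for a c N
  proof -
    have far: "i \<in> far c N" if "i \<in> I" "N \<le> graph_dist Q (cell c) i" for i
      unfolding far_def
    proof (intro CollectI conjI ballI)
      fix p assume "p \<in> P i"
      then show "N \<le> graph_dist A c p"
        using graph_dist_cell[OF c part_verts[OF that(1)]] cell_eq[OF that(1)] that(2) by fastforce
    qed (rule that(1))
    have ca: "cell c \<in> verts Q" "cell a \<in> verts Q"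
      using cell_in a c by (auto simp: verts_Q)
    show ?thesis
    proof (cases "N \<le> graph_dist Q (cell c) (cell a)")
      case True
      then show ?thesis
        using far[OF cell_in(1)[OF a] True] cell_in(2)[OF a] walk_le_refl by (intro bexI)
    next
      case False
      obtain i where i: "i \<in> I" "graph_dist Q (cell a) i = 2 * N"
        using ex_graph_dist_eq[OF simple_Q connected_Q fin _ ca(2)] inf by (auto simp: verts_Q)
      have "graph_dist Q (cell a) i \<le> graph_dist Q (cell c) (cell a) + graph_dist Q (cell c) i"
        using graph_dist_triangle[OF simple_Q connected_Q ca(2,1), of i]
          graph_dist_sym[OF simple_Q connected_Q ca] i(1) by (simp add: verts_Q)
      then have "i \<in> far c N"
        using False i far by simp
      moreover have "(cell a, i) \<in> edges Q ^^ (2 * N)"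
        using graph_dist_walk[OF simple_Q connected_Q ca(2), of i] i by (simp add: verts_Q)
      then obtain p where p: "p \<in> P i" "graph_dist A a p \<le> M * (2 * N)"
        using near[OF a] by blast
      then have "walk_le (edges A) (2 * M * N) a p"
        using graph_dist_le_iff[OF A a part_verts[OF i(1)]] by (simp add: ac_simps)
      ultimately show ?thesis
        using p(1) by blast
    qed
  qed
  then show ?thesis
    by blast
qed

text \<open>Both endpoints escape to far cells, where \<open>far_cells_joined\<close> applies to the
  given walk extended by the two escapes, of length \<open>D + 2 * M * N\<close>. With the escapes
  themselves the total is \<open>4 * D + 10 * M * N + 4\<close>.\<close>

lemma ex_detour:
  assumes two: "\<exists>u\<in>verts B. \<exists>v\<in>verts B. u \<noteq> v"
    and trans: "transitive_family A I P" and fin: "locally_finite Q" and inf: "infinite I"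
  shows "\<exists>M. \<forall>c\<in>verts W. \<forall>x\<in>verts W. \<forall>y\<in>verts W. \<forall>N D.
    walk_le (edges W) D x y \<longrightarrow>
    (M + 1) * N \<le> graph_dist W c x \<longrightarrow> (M + 1) * N \<le> graph_dist W c y \<longrightarrow>
    walk_le (Restr (edges W) {v. N \<le> graph_dist W c v}) (4 * D + 10 * M * N + 4) x y"
proof -
  obtain M where M: "\<And>a c N. a \<in> verts A \<Longrightarrow> c \<in> verts A \<Longrightarrow>
      \<exists>i\<in>far c N. \<exists>p\<in>P i. walk_le (edges A) (M * N) a p"
    using ex_far_cell_near[OF trans fin inf] by blast
  have "walk_le (Restr (edges W) (outside c N)) (4 * D + 10 * M * N + 4) x y"
    if c: "c \<in> verts W" and x: "x \<in> verts W" and y: "y \<in> verts W"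
      and walk: "walk_le (edges W) D x y"
      and dist: "(M + 1) * N \<le> graph_dist W c x" "(M + 1) * N \<le> graph_dist W c y" for c x y N D
  proof -
    let ?R = "Restr (edges W) (outside c N)"
    have sym: "sym ?R"
      using sym_edges[OF simple_W connected_W] by (auto simp: sym_def)
    \<comment> \<open>The unrestricted copy extends the given walk between the far cells; the
      restricted copy becomes part of the detour.\<close>
    have escape: "\<exists>i\<in>far (snd c) N. \<exists>p\<in>P i. walk_le (edges W) (M * N) (f, a) (f, p) \<and>
        walk_le ?R (M * N) (f, a) (f, p)"
      if V: "(f, a) \<in> verts W" and d: "(M + 1) * N \<le> graph_dist W c (f, a)" for f a
    proof -
      have fa: "f \<in> configs" "a \<in> verts A" "snd c \<in> verts A"
        using V c by (auto simp: verts_W)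
      obtain i p where ip: "i \<in> far (snd c) N" "p \<in> P i" "walk_le (edges A) (M * N) a p"
        using M[OF fa(2,3)] by blast
      then have "p \<in> verts A"
        using part_verts by (auto simp: far_def)
      then have "(f, p) \<in> verts W"
        using fa by (simp add: verts_W)
      then have "walk_le ?R (M * N) (f, a) (f, p)"
        unfolding outside_def using d
        by (intro walk_avoids_ball[OF simple_W connected_W c V _ walk_move[OF fa(1) ip(3)]]) auto
      then show ?thesis
        using ip walk_move[OF fa(1) ip(3)] by blast
    qed
    obtain f a g b where xy: "x = (f, a)" "y = (g, b)"
      by fastforce
    have fg: "f \<in> configs" "g \<in> configs"
      using x y xy by (auto simp: verts_W)
    obtain i p where ip: "i \<in> far (snd c) N" "p \<in> P i" "walk_le (edges W) (M * N) x (f, p)"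
        "walk_le ?R (M * N) x (f, p)"
      using escape[of f a] x dist xy by blast
    obtain j q where jq: "j \<in> far (snd c) N" "q \<in> P j" "walk_le (edges W) (M * N) y (g, q)"
        "walk_le ?R (M * N) y (g, q)"
      using escape[of g b] y dist xy by blast
    have "walk_le (edges W) (M * N + D + M * N) (f, p) (g, q)"
      by (rule walk_le_trans[OF walk_le_trans[OF walk_le_sym[OF sym_edges[OF simple_W connected_W]
              ip(3)] walk] jq(3)])
    then have "walk_le ?R (4 * (M * N + D + M * N) + 4) (f, p) (g, q)"
      by (rule far_cells_joined[OF two c fg ip(1,2) jq(1,2)])
    from walk_le_trans[OF walk_le_trans[OF ip(4) this] walk_le_sym[OF sym jq(4)]]
    show ?thesis
      by (rule walk_le_mono) (simp add: algebra_simps)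
  qed
  then show ?thesis
    unfolding outside_def by blast
qed

end


section \<open>Lipschitz curves in the realization\<close>

text \<open>The parameter interval has length \<open>l\<close> instead of one, so that concatenation
  adds lengths without rescaling and keeps Lipschitz constant one.\<close>

definition lip_joined :: "'x metric \<Rightarrow> 'x set \<Rightarrow> real \<Rightarrow> 'x \<Rightarrow> 'x \<Rightarrow> bool" where
  "lip_joined X S l x y \<longleftrightarrow> 0 \<le> l \<and>
     (\<exists>g. g 0 = x \<and> g l = y \<and> g ` {0..l} \<subseteq> S \<and>
       (\<forall>s t. 0 \<le> s \<longrightarrow> s \<le> t \<longrightarrow> t \<le> l \<longrightarrow> mdist X (g s) (g t) \<le> t - s))"

lemma lip_joined_refl:
  assumes "x \<in> S" "S \<subseteq> mspace X"
  shows "lip_joined X S 0 x x"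
proof -
  have "x \<in> mspace X"
    using assms by blast
  then have "mdist X x x = 0"
    by simp
  then show ?thesis
    unfolding lip_joined_def using assms(1) by (intro conjI exI[of _ "\<lambda>_. x"]) auto
qed

lemma lip_joined_sym:
  assumes "lip_joined X S l x y"
  shows "lip_joined X S l y x"
proof -
  obtain g where g: "0 \<le> l" "g 0 = x" "g l = y" "g ` {0..l} \<subseteq> S"
      "\<And>s t. 0 \<le> s \<Longrightarrow> s \<le> t \<Longrightarrow> t \<le> l \<Longrightarrow> mdist X (g s) (g t) \<le> t - s"
    using assms unfolding lip_joined_def by blast
  have "mdist X (g (l - s)) (g (l - t)) \<le> t - s" if "0 \<le> s" "s \<le> t" "t \<le> l" for s t
    using g(5)[of "l - t" "l - s"] that by (simp add: mdist_commute)
  moreover have "(\<lambda>t. g (l - t)) ` {0..l} \<subseteq> S"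
    using g(4) by (auto simp: image_subset_iff)
  ultimately show ?thesis
    unfolding lip_joined_def using g(1-3) by (intro conjI exI[of _ "\<lambda>t. g (l - t)"]) auto
qed

text \<open>Only parameters on different sides of the junction need an argument: the triangle
  inequality through \<open>y\<close>.\<close>

lemma lip_joined_trans:
  assumes "S \<subseteq> mspace X" "lip_joined X S l x y" "lip_joined X S m y z"
  shows "lip_joined X S (l + m) x z"
proof -
  obtain g where g: "0 \<le> l" "g 0 = x" "g l = y" "g ` {0..l} \<subseteq> S"
      "\<And>s t. 0 \<le> s \<Longrightarrow> s \<le> t \<Longrightarrow> t \<le> l \<Longrightarrow> mdist X (g s) (g t) \<le> t - s"
    using assms(2) unfolding lip_joined_def by blast
  obtain h where h: "0 \<le> m" "h 0 = y" "h m = z" "h ` {0..m} \<subseteq> S"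
      "\<And>s t. 0 \<le> s \<Longrightarrow> s \<le> t \<Longrightarrow> t \<le> m \<Longrightarrow> mdist X (h s) (h t) \<le> t - s"
    using assms(3) unfolding lip_joined_def by blast
  define k where "k t = (if t \<le> l then g t else h (t - l))" for t
  have in_g: "g t \<in> mspace X" if "0 \<le> t" "t \<le> l" for t
    using g(4) assms(1) that by (auto simp: image_subset_iff)
  have in_h: "h t \<in> mspace X" if "0 \<le> t" "t \<le> m" for t
    using h(4) assms(1) that by (auto simp: image_subset_iff)
  have "mdist X (k s) (k t) \<le> t - s" if st: "0 \<le> s" "s \<le> t" "t \<le> l + m" for s t
  proof -
    consider "t \<le> l" | "l < s" | "s \<le> l" "l < t"
      by linarith
    then show ?thesis
    proof cases
      case 3
      then have "mdist X (g s) (h (t - l)) \<le> mdist X (g s) y + mdist X y (h (t - l))"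
        using in_g[of s] in_g[of l] in_h[of "t - l"] st g(1,3) by (intro mdist_triangle) auto
      moreover have "mdist X (g s) y \<le> l - s" "mdist X y (h (t - l)) \<le> t - l"
        using g(3) g(5)[of s l] h(2) h(5)[of 0 "t - l"] 3 st by auto
      ultimately show ?thesis
        using 3 by (simp add: k_def)
    qed (use g(5)[of s t] h(5)[of "s - l" "t - l"] st in \<open>auto simp: k_def\<close>)
  qed
  moreover have "k ` {0..l + m} \<subseteq> S"
    using g(4) h(4) by (auto simp: k_def image_subset_iff)
  moreover have "k 0 = x" "k (l + m) = z"
    using g(1-3) h(1-3) by (auto simp: k_def)
  ultimately show ?thesis
    unfolding lip_joined_def using g(1) h(1) by (intro conjI exI[of _ k]) auto
qed

lemma path_length_le:
  assumes l: "0 \<le> l"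
    and lip: "\<And>s t. 0 \<le> s \<Longrightarrow> s \<le> t \<Longrightarrow> t \<le> 1 \<Longrightarrow> mdist X (g s) (g t) \<le> l * (t - s)"
  shows "path_length X g \<le> ennreal l"
  unfolding path_length_def
proof (rule SUP_least, clarify)
  fix ts :: "real list"
  assume ts: "sorted ts" "set ts \<subseteq> {0..1}"
  let ?n = "length ts - 1"
  have in01: "0 \<le> ts ! k" "ts ! k \<le> 1" if "k < length ts" for k
    using ts(2) nth_mem[OF that] by auto
  have mono: "ts ! k \<le> ts ! Suc k" if "k < ?n" for k
    using ts(1) that by (auto intro: sorted_nth_mono)
  have "(\<Sum>k<?n. ennreal (mdist X (g (ts ! k)) (g (ts ! Suc k))))
      = ennreal (\<Sum>k<?n. mdist X (g (ts ! k)) (g (ts ! Suc k)))"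
    by (rule sum_ennreal) simp
  also have "\<dots> \<le> ennreal l"
  proof (rule ennreal_leI)
    have "(\<Sum>k<?n. mdist X (g (ts ! k)) (g (ts ! Suc k))) \<le> (\<Sum>k<?n. l * (ts ! Suc k - ts ! k))"
      using in01 mono by (intro sum_mono lip) auto
    also have "\<dots> = l * (ts ! ?n - ts ! 0)"
      by (simp add: sum_lessThan_telescope flip: sum_distrib_left)
    also have "\<dots> \<le> l"
    \<comment> \<open>For the empty list, truncated subtraction makes \<open>?n\<close> zero and the
      telescoped difference vanishes.\<close>
    proof (cases "ts = []")
      case False
      then show ?thesis
        using in01[of 0] in01[of ?n] l by (intro mult_left_le) auto
    qed (simp add: l)
    finally show "(\<Sum>k<?n. mdist X (g (ts ! k)) (g (ts ! Suc k))) \<le> l" .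
  qed
  finally show "(\<Sum>k<?n. ennreal (mdist X (g (ts ! k)) (g (ts ! Suc k)))) \<le> ennreal l" .
qed

text \<open>Rescaling the curve to the unit interval makes it \<open>l\<close>-Lipschitz, hence a
  continuous path of length at most \<open>l\<close> that competes in the infimum.\<close>

lemma div_at_le:
  assumes "lip_joined X (mspace X - mball_of X c (\<delta> * min (mdist X c a) (mdist X c b) - \<gamma>)) l a b"
  shows "div_at X \<gamma> \<delta> a b c \<le> ennreal l"
proof -
  let ?S = "mspace X - mball_of X c (\<delta> * min (mdist X c a) (mdist X c b) - \<gamma>)"
  obtain g where g: "0 \<le> l" "g 0 = a" "g l = b" "g ` {0..l} \<subseteq> ?S"
      "\<And>s t. 0 \<le> s \<Longrightarrow> s \<le> t \<Longrightarrow> t \<le> l \<Longrightarrow> mdist X (g s) (g t) \<le> t - s"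
    using assms unfolding lip_joined_def by blast
  define h where "h t = g (l * t)" for t
  have range: "0 \<le> l * t" "l * t \<le> l" if "0 \<le> t" "t \<le> 1" for t
    using that g(1) by (auto intro: mult_left_le)
  have lip: "mdist X (h s) (h t) \<le> l * (t - s)" if "0 \<le> s" "s \<le> t" "t \<le> 1" for s t
    using g(5)[of "l * s" "l * t"] range[of s] range[of t] that mult_left_mono[OF that(2) g(1)]
    by (simp add: h_def right_diff_distrib)
  have S: "h t \<in> ?S" if "0 \<le> t" "t \<le> 1" for t
    using g(4) range[OF that] by (auto simp only: h_def image_subset_iff atLeastAtMost_iff)
  have "Lipschitz_continuous_map (submetric euclidean_metric {0..1}) X h"
    unfolding Lipschitz_continuous_map_def
  proof (intro conjI exI[of _ l] ballI)
    show "h \<in> mspace (submetric euclidean_metric {0..1}) \<rightarrow> mspace X"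
      using S by auto
    fix s t assume "s \<in> mspace (submetric euclidean_metric {0..1::real})"
      "t \<in> mspace (submetric euclidean_metric {0..1::real})"
    then show "mdist X (h s) (h t) \<le> l * mdist (submetric euclidean_metric {0..1}) s t"
      using lip[of s t] lip[of t s] by (cases "s \<le> t") (auto simp: mdist_commute dist_real_def)
  qed
  then have "pathin (mtopology_of X) h"
    using Lipschitz_continuous_imp_continuous_map by (fastforce simp: pathin_def mtopology_of_submetric)
  then have "pathin (subtopology (mtopology_of X) ?S) h"
    using S by (auto simp: pathin_subtopology)
  moreover have "h 0 = a" "h 1 = b"
    using g(2,3) by (auto simp: h_def)
  ultimately have "div_at X \<gamma> \<delta> a b c \<le> path_length X h"
    unfolding div_at_def Let_def by (intro INF_lower) auto
  also have "\<dots> \<le> ennreal l"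
    using g(1) lip by (rule path_length_le)
  finally show ?thesis .
qed

definition edge_point :: "'v \<Rightarrow> 'v \<Rightarrow> real \<Rightarrow> 'v \<Rightarrow> real" where
  "edge_point u v t = (\<lambda>w. if w = u then 1 - t else if w = v then t else 0)"

section \<open>Curves in the realization along walks of the graph\<close>

context
  fixes G :: "'v graph"
  assumes simple: "simple_graph G" and conn: "connected_graph G"
begin

lemma mspace_realization: "mspace (realization G) = realization_points G"
  and mdist_realization: "mdist (realization G) = realization_dist G"
  using Metric_space.mspace_metric Metric_space.mdist_metric Metric_space_realization[OF simple conn]
  unfolding realization_def by blast+

lemma supp_vertex [simp]: "supp (indicat_real {v}) = {v}"
  by (auto simp: supp_def indicator_def split: if_splits)

lemma vertex_point: "v \<in> verts G \<Longrightarrow> indicat_real {v} \<in> realization_points G"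
  by (auto simp: realization_points_def)

lemma realization_dist_le:
  "x \<in> realization_points G \<Longrightarrow> y \<in> realization_points G \<Longrightarrow> r \<in> route_lengths G x y \<Longrightarrow>
   realization_dist G x y \<le> r"
  unfolding realization_dist_def using route_bdd_below[OF simple conn] by (auto intro: cInf_lower)

text \<open>The only vertex route has the graph distance as its length. A route inside an edge
  competes only if \<open>u\<close> and \<open>v\<close> lie on one edge, and then it is no
  shorter.\<close>

lemma realization_dist_vertices:
  assumes "u \<in> verts G" "v \<in> verts G"
  shows "realization_dist G (indicat_real {u}) (indicat_real {v}) = real (graph_dist G u v)"
proof -
  have "real (graph_dist G u v) \<in> route_lengths G (indicat_real {u}) (indicat_real {v})"
    using vertex_route[OF simple conn, of u "indicat_real {u}" v "indicat_real {v}"] by simp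
  moreover have "real (graph_dist G u v) \<le> r"
    if r: "r \<in> route_lengths G (indicat_real {u}) (indicat_real {v})" for r
  proof -
    consider "r = real (graph_dist G u v)"
      | p q where "(p, q) \<in> edges G" "u \<in> {p, q}" "v \<in> {p, q}"
          "r = \<bar>indicat_real {u} p - indicat_real {v} p\<bar>"
      using r by (auto simp: route_lengths_def)
    then show ?thesis
    proof cases
      case 2
      show ?thesis
      proof (cases "u = v")
        case True
        then show ?thesis
          using 2 graph_dist_refl[OF simple conn] by simp
      next
        case False
        then have "(u, v) \<in> edges G"
          using 2 edge_verts[OF simple conn 2(1)] by auto
        then have "graph_dist G u v \<le> 1"
          by (rule graph_dist_edge[OF simple conn])
        moreover have "r = 1"
          using 2 False by auto
        ultimately show ?thesis
          by simp
      qed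
    qed simp
  qed
  ultimately have "Inf (route_lengths G (indicat_real {u}) (indicat_real {v})) = real (graph_dist G u v)"
    by (rule cInf_eq_minimum)
  then show ?thesis
    using assms vertex_point by (simp add: realization_dist_def)
qed

lemma realization_dist_to_vertex:
  assumes "x \<in> realization_points G" "u \<in> supp x"
  shows "realization_dist G x (indicat_real {u}) \<le> 1"
proof -
  have "u \<in> verts G"
    using point_verts[OF simple conn] assms by blast
  then have "realization_dist G x (indicat_real {u}) \<le> 1 - x u"
    using vertex_route[OF simple conn assms(2), of u "indicat_real {u}"] assms(1)
      graph_dist_refl[OF simple conn, of u] vertex_point
    by (intro realization_dist_le) auto
  then show ?thesis
    using point_nonneg[OF simple conn assms(1), of u] by linarith
qed

lemma edge_point_in:
  assumes "(u, v) \<in> edges G" "0 \<le> t" "t \<le> 1"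
  shows "edge_point u v t \<in> realization_points G"
proof -
  have uv: "u \<in> verts G" "v \<in> verts G" "u \<noteq> v"
    using edge_verts[OF simple conn assms(1)] by auto
  \<comment> \<open>At the ends of the edge the support shrinks to one vertex, which falls under the
    other clause of \<open>realization_points\<close>.\<close>
  consider "t = 0" | "t = 1" | "0 < t" "t < 1"
    using assms by linarith
  then show ?thesis
  proof cases
    case 3
    then have supp: "supp (edge_point u v t) = {u, v}"
      by (auto simp: supp_def edge_point_def)
    have "sum (edge_point u v t) {u, v} = 1"
      using uv(3) by (simp add: edge_point_def)
    moreover have "\<forall>w. 0 \<le> edge_point u v t w"
      using assms by (simp add: edge_point_def)
    ultimately show ?thesis
      unfolding realization_points_def mem_Collect_eq supp using assms(1) by blast
  next
    case 1
    then have "edge_point u v t = indicat_real {u}"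
      by (auto simp: edge_point_def indicator_def)
    then show ?thesis
      using vertex_point uv by simp
  next
    case 2
    then have "edge_point u v t = indicat_real {v}"
      using uv(3) by (auto simp: edge_point_def indicator_def)
    then show ?thesis
      using vertex_point uv by simp
  qed
qed

text \<open>All points of the edge lie within distance one of \<open>v\<close>, so it suffices that
  \<open>S\<close> contains the closed unit ball around \<open>v\<close>.\<close>

lemma edge_point_joined:
  assumes e: "(u, v) \<in> edges G" and t: "0 \<le> t" "t \<le> 1"
    and S: "\<And>x. x \<in> realization_points G \<Longrightarrow> realization_dist G x (indicat_real {v}) \<le> 1 \<Longrightarrow> x \<in> S"
  shows "lip_joined (realization G) S (1 - t) (edge_point u v t) (indicat_real {v})"
proof -
  define g where "g s = edge_point u v (t + s)" for s
  have uv: "u \<in> verts G" "v \<in> verts G" "u \<noteq> v"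
    using edge_verts[OF simple conn e] by auto
  have supp: "supp (edge_point u v s) \<subseteq> {u, v}" for s
    by (auto simp: supp_def edge_point_def split: if_splits)
  have one: "edge_point u v 1 = indicat_real {v}"
    using uv(3) by (auto simp: edge_point_def indicator_def)
  have lip: "realization_dist G (edge_point u v r) (edge_point u v s) \<le> \<bar>r - s\<bar>"
    if "0 \<le> r" "r \<le> 1" "0 \<le> s" "s \<le> 1" for r s
  proof -
    have "realization_dist G (edge_point u v r) (edge_point u v s)
        \<le> \<bar>edge_point u v r u - edge_point u v s u\<bar>"
      by (intro realization_dist_le edge_point_in[OF e] that edge_route[OF simple conn e] supp)
    also have "\<dots> = \<bar>r - s\<bar>"
      by (simp add: edge_point_def)
    finally show ?thesis .
  qed
  have "edge_point u v s \<in> S" if "0 \<le> s" "s \<le> 1" for s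
    using lip[of s 1] that by (intro S edge_point_in[OF e]) (auto simp: one)
  then show ?thesis
    unfolding lip_joined_def mdist_realization using t lip
    by (intro conjI exI[of _ g]) (auto simp: g_def one intro!: order.trans[OF lip])
qed

lemma point_joined_vertex:
  assumes x: "x \<in> realization_points G" and v: "v \<in> supp x"
    and S: "S \<subseteq> realization_points G"
      "\<And>y. y \<in> realization_points G \<Longrightarrow> realization_dist G y (indicat_real {v}) \<le> 1 \<Longrightarrow> y \<in> S"
  shows "\<exists>l\<le>1. lip_joined (realization G) S l x (indicat_real {v})"
proof (cases "supp x = {v}")
  case True
  then have "x = indicat_real {v}"
    using point_vertex[OF simple conn x, of v] point_zero[OF simple conn, of _ x]
    by (auto simp: fun_eq_iff indicator_def)
  moreover have "x \<in> S"
    using S(2)[OF x] realization_dist_to_vertex[OF x v] by blast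
  ultimately show ?thesis
    using lip_joined_refl[of x S "realization G"] S(1) mspace_realization
    by (intro exI[of _ 0]) auto
next
  case False
  then obtain u where u: "u \<in> supp x" "u \<noteq> v"
    using v by blast
  note e = point_edge[OF simple conn x u(1) v u(2)]
  have "x = edge_point u v (x v)"
    using e point_zero[OF simple conn, of _ x] u(2) by (auto simp: fun_eq_iff edge_point_def)
  moreover have "0 \<le> x v" "x v \<le> 1"
    using point_nonneg[OF simple conn x] point_le_1[OF simple conn x] by auto
  ultimately show ?thesis
    using edge_point_joined[OF e(1), of "x v" S] S(2) by (intro exI[of _ "1 - x v"]) auto
qed

lemma walk_joined:
  assumes S: "S \<subseteq> realization_points G"
      "\<And>v y. v \<in> V \<Longrightarrow> y \<in> realization_points G \<Longrightarrow> realization_dist G y (indicat_real {v}) \<le> 1 \<Longrightarrow> y \<in> S"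
    and u: "u \<in> V" "u \<in> verts G" and walk: "(u, v) \<in> Restr (edges G) V ^^ n"
  shows "lip_joined (realization G) S (real n) (indicat_real {u}) (indicat_real {v})"
  using walk
proof (induction n arbitrary: v)
  case 0
  have "indicat_real {u} \<in> S"
    using S(2)[OF u(1) vertex_point[OF u(2)]] realization_dist_vertices[OF u(2) u(2)]
      graph_dist_refl[OF simple conn] by simp
  then show ?case
    using 0 lip_joined_refl[of _ S "realization G"] S(1) mspace_realization by auto
next
  case (Suc n)
  then obtain w where w: "(u, w) \<in> Restr (edges G) V ^^ n" "(w, v) \<in> edges G" "v \<in> V"
    by auto
  have "indicat_real {w} = edge_point w v 0"
    by (auto simp: edge_point_def indicator_def)
  then have "lip_joined (realization G) S 1 (indicat_real {w}) (indicat_real {v})"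
    using edge_point_joined[OF w(2), of 0 S] S(2)[OF w(3)] by simp
  then show ?case
    using lip_joined_trans[of S "realization G" "real n"] Suc.IH[OF w(1)] S(1) mspace_realization
    by (fastforce simp: add.commute)
qed


text \<open>Each point is within distance one of every vertex in its support, and the two errors add
  up.\<close>

lemma graph_dist_approx:
  assumes "x \<in> realization_points G" "y \<in> realization_points G" "u \<in> supp x" "v \<in> supp y"
  shows "\<bar>real (graph_dist G u v) - realization_dist G x y\<bar> \<le> 2"
proof -
  interpret Metric_space "realization_points G" "realization_dist G"
    by (rule Metric_space_realization[OF simple conn])
  have V: "u \<in> verts G" "v \<in> verts G"
    using point_verts[OF simple conn] assms by auto
  let ?u = "indicat_real {u}" and ?v = "indicat_real {v}"
  have "realization_dist G ?u ?v = real (graph_dist G u v)"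
    by (rule realization_dist_vertices[OF V])
  moreover have "realization_dist G x ?u \<le> 1" "realization_dist G y ?v \<le> 1"
    using realization_dist_to_vertex assms by auto
  moreover have "realization_dist G x y \<le> realization_dist G x ?u + realization_dist G ?u ?v + realization_dist G ?v y"
    using triangle[of x ?u y] triangle[of ?u ?v y] assms V vertex_point by simp
  moreover have "realization_dist G ?u ?v \<le> realization_dist G ?u x + realization_dist G x y + realization_dist G y ?v"
    using triangle[of ?u x ?v] triangle[of x y ?v] assms V vertex_point by simp
  ultimately show ?thesis
    using commute[of x ?u] commute[of y ?v] by linarith
qed

text \<open>The margin 2 in the radius pays for the step from \<open>c\<close> to \<open>w\<close>
  and for the step from a point of an edge to a vertex of the walk. The extra length 2 joins
  \<open>x\<close> to \<open>u\<close> and \<open>v\<close> to \<open>y\<close>.\<close>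

lemma points_joined:
  assumes x: "x \<in> realization_points G" "u \<in> supp x" and y: "y \<in> realization_points G" "v \<in> supp y"
    and c: "c \<in> realization_points G" "w \<in> supp c"
    and walk: "walk_le (Restr (edges G) {z. N \<le> graph_dist G w z}) n u v"
    and N: "N \<le> graph_dist G w u" "N \<le> graph_dist G w v" "\<rho> + 2 \<le> real N"
  shows "\<exists>l\<le>real n + 2. lip_joined (realization G)
    (mspace (realization G) - mball_of (realization G) c \<rho>) l x y"
proof -
  let ?S = "mspace (realization G) - mball_of (realization G) c \<rho>"
  interpret Metric_space "realization_points G" "realization_dist G"
    by (rule Metric_space_realization[OF simple conn])
  have S: "?S \<subseteq> realization_points G"
    by (auto simp: mspace_realization)
  have V: "u \<in> verts G" "v \<in> verts G" "w \<in> verts G"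
    using point_verts[OF simple conn] x y c by auto
  have near: "p \<in> ?S" if z: "N \<le> graph_dist G w z" "z \<in> verts G" and p: "p \<in> realization_points G"
      and pz: "realization_dist G p (indicat_real {z}) \<le> 1" for z p
  proof -
    let ?w = "indicat_real {w}" and ?z = "indicat_real {z}"
    have "real (graph_dist G w z) = realization_dist G ?w ?z"
      using realization_dist_vertices V(3) z(2) by simp
    also have "\<dots> \<le> realization_dist G ?w c + realization_dist G c p + realization_dist G p ?z"
      using triangle[of ?w c ?z] triangle[of c p ?z] c(1) p V(3) z(2) vertex_point by simp
    also have "\<dots> \<le> realization_dist G c p + 2"
      using realization_dist_to_vertex[OF c] pz commute[of c ?w] by simp
    finally have "\<rho> \<le> realization_dist G c p"
      using z(1) N(3) by linarith
    then show ?thesis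
      using p by (simp add: mspace_realization mdist_realization)
  qed
  obtain l where l: "l \<le> 1" "lip_joined (realization G) ?S l x (indicat_real {u})"
    using point_joined_vertex[OF x S] near[OF N(1) V(1)] by blast
  obtain m where m: "m \<le> 1" "lip_joined (realization G) ?S m y (indicat_real {v})"
    using point_joined_vertex[OF y S] near[OF N(2) V(2)] by blast
  obtain k where k: "k \<le> n" "(u, v) \<in> Restr (edges G) {z. N \<le> graph_dist G w z} ^^ k"
    using walk unfolding walk_le_def by blast
  \<comment> \<open>\<open>near\<close> holds for vertices only, so the restricting set is cut down
    to vertices; this leaves the relation unchanged.\<close>
  have eq: "Restr (edges G) {z. N \<le> graph_dist G w z} =
      Restr (edges G) {z \<in> verts G. N \<le> graph_dist G w z}"
    using edges_in_verts[OF simple conn] by blast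
  have "lip_joined (realization G) ?S (real k) (indicat_real {u}) (indicat_real {v})"
    by (rule walk_joined[OF S _ _ V(1) k(2)[unfolded eq]]) (use near N(1) V(1) in auto)
  then have "lip_joined (realization G) ?S (l + real k + m) x y"
    using lip_joined_trans[OF _ lip_joined_trans[OF _ l(2)] lip_joined_sym[OF m(2)]] by blast
  then show ?thesis
    using l(1) m(1) k(1) by (intro exI[of _ "l + real k + m"]) auto
qed

text \<open>
  Write \<open>r\<close> for the distance from \<open>c\<close> to the nearer endpoint. If \<open>x\<close> and \<open>y\<close> are at distance at
  most about \<open>r / 2\<close>, a geodesic avoids the ball. Otherwise a detour of length \<open>O(r)\<close> is affordable,
  and \<open>\<delta>\<close> is chosen so small that the hypothesis provides one.
\<close>

lemma linear_divergence_if_detours: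
  assumes detour: "\<And>c x y N D. c \<in> verts G \<Longrightarrow> x \<in> verts G \<Longrightarrow> y \<in> verts G \<Longrightarrow>
    walk_le (edges G) D x y \<Longrightarrow>
    (M + 1) * N \<le> graph_dist G c x \<Longrightarrow> (M + 1) * N \<le> graph_dist G c y \<Longrightarrow>
    walk_le (Restr (edges G) {v. N \<le> graph_dist G c v}) (4 * D + 10 * M * N + 4) x y"
  shows "linear_divergence (realization G)"
proof -
  define \<delta> where "\<delta> = 1 / (2 * (real M + 1))"
  let ?X = "realization G"
  have \<delta>: "0 < \<delta>" "\<delta> \<le> 1 / 2" "(real M + 1) * \<delta> = 1 / 2"
    by (auto simp: \<delta>_def field_simps)
  have div: "div_at ?X 6 \<delta> x y c \<le> ennreal (14 * mdist ?X x y + 54)"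
    if x: "x \<in> realization_points G" and y: "y \<in> realization_points G"
      and c: "c \<in> realization_points G" for x y c
  proof -
    define r where "r = min (mdist ?X c x) (mdist ?X c y)"
    define d where "d = mdist ?X x y"
    \<comment> \<open>The ball removed has radius \<open>\<delta> * r - 6\<close>, and
      \<open>points_joined\<close> needs a margin of 2. Rounding up still leaves \<open>N\<close> at
      most \<open>\<delta> * r\<close>, and \<open>nat\<close> gives 0 for small
      \<open>r\<close>.\<close>
    define N where "N = nat \<lceil>\<delta> * r - 4\<rceil>"
    obtain u v w where supp: "u \<in> supp x" "v \<in> supp y" "w \<in> supp c"
      using point_nonempty[OF simple conn x] point_nonempty[OF simple conn y]
        point_nonempty[OF simple conn c] by (metis ex_in_conv)
    define D where "D = graph_dist G u v"
    have V: "u \<in> verts G" "v \<in> verts G" "w \<in> verts G"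
      using point_verts[OF simple conn] x y c supp by auto
    have r: "0 \<le> r" "r - 2 \<le> graph_dist G w u" "r - 2 \<le> graph_dist G w v"
      using graph_dist_approx[OF c x supp(3,1)] graph_dist_approx[OF c y supp(3,2)]
      by (auto simp: r_def mdist_realization[symmetric])
    have d: "0 \<le> d" "real D \<le> d + 2"
      using graph_dist_approx[OF x y supp(1,2)] by (auto simp: d_def D_def mdist_realization[symmetric])
    have walk: "walk_le (edges G) D u v"
      using graph_dist_le_iff[OF simple conn V(1,2)] D_def by blast
    have "\<delta> * r - 4 \<le> real N"
      unfolding N_def by linarith
    then have N: "\<delta> * r - 6 + 2 \<le> real N"
      by simp
    have "0 \<le> \<delta> * r"
      using \<delta>(1) r(1) by simp
    then have N_le: "real N \<le> \<delta> * r"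
      unfolding N_def by linarith
    have "(real M + 1) * real N \<le> (real M + 1) * (\<delta> * r)"
      using N_le by (intro mult_left_mono) auto
    also have "\<dots> = r / 2"
      using \<delta>(3) by (simp flip: mult.assoc)
    finally have MN: "(real M + 1) * real N \<le> r / 2" .
    \<comment> \<open>For positive \<open>N\<close> one has \<open>4 < \<delta> * r\<close>, so
      \<open>r\<close> is large enough for \<open>r / 2\<close> to absorb the error 2 of the passage
      to vertices.\<close>
    have far: "(M + 1) * N \<le> graph_dist G w z" if "r - 2 \<le> graph_dist G w z" for z
    proof (cases "N = 0")
      case False
      then have "4 < \<delta> * r"
        unfolding N_def by linarith
      also have "\<delta> * r \<le> 1 / 2 * r"
        using \<delta>(2) r(1) by (intro mult_right_mono)
      finally have "r / 2 \<le> r - 2"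
        by simp
      then have "real ((M + 1) * N) \<le> real (graph_dist G w z)"
        using MN that by (simp add: algebra_simps)
      then show ?thesis
        by linarith
    qed simp
    then have MNd: "(M + 1) * N \<le> graph_dist G w u" "(M + 1) * N \<le> graph_dist G w v"
      using r by auto
    then have Nd: "N \<le> graph_dist G w u" "N \<le> graph_dist G w v"
      by auto
    have "\<exists>n. real n + 2 \<le> 14 * d + 54 \<and>
      walk_le (Restr (edges G) {z. N \<le> graph_dist G w z}) n u v"
    \<comment> \<open>The threshold is what \<open>N + D \<le> r / 2 + d + 2 \<le> r - 2\<close>
      requires for the shortest walk to avoid the ball.\<close>
    proof (cases "2 * d + 8 \<le> r")
      case True
      have "real N \<le> 1 / 2 * r"
        using N_le mult_right_mono[OF \<delta>(2) r(1)] by linarith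
      then have "real (N + D) \<le> real (graph_dist G w u)"
        using True d(2) r(2) by simp
      then have "N + D \<le> graph_dist G w u"
        by linarith
      then show ?thesis
        using walk_avoids_ball[OF simple conn V(3,1,2) walk] d by (intro exI[of _ D]) auto
    next
      case False
      have "real M * real N \<le> r / 2"
        using MN by (simp add: algebra_simps)
      \<comment> \<open>Here \<open>D\<close> is at most \<open>d + 2\<close> and
        \<open>10 * M * N\<close> at most \<open>5 * r\<close>, where \<open>r < 2 * d + 8\<close>.
        This is the source of the constants 14 and 54.\<close>
      then have "real (4 * D + 10 * M * N + 4) + 2 \<le> 14 * d + 54"
        using False d by simp
      then show ?thesis
        using detour[OF V(3,1,2) walk MNd] by blast
    qed
    then obtain n l where nl: "real n + 2 \<le> 14 * d + 54" "l \<le> real n + 2"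
        "lip_joined ?X (mspace ?X - mball_of ?X c (\<delta> * r - 6)) l x y"
      using points_joined[OF x supp(1) y supp(2) c supp(3) _ Nd N] by blast
    have "div_at ?X 6 \<delta> x y c \<le> ennreal l"
      using nl(3) unfolding r_def by (rule div_at_le)
    also have "\<dots> \<le> ennreal (14 * d + 54)"
      using nl by (intro ennreal_leI) linarith
    finally show ?thesis
      by (simp add: d_def)
  qed
  \<comment> \<open>The shape required by \<open>preceq\<close> for the constant 54; its additive
    term alone covers the linear bound.\<close>
  have "Div ?X 6 \<delta> n \<le> ennreal 54 * ennreal (54 * n + 54) + ennreal (54 * n + 54)"
    if n: "0 \<le> n" for n
  proof -
    have "Div ?X 6 \<delta> n \<le> ennreal (54 * n + 54)"
      unfolding Div_def
    proof (rule SUP_least, clarify)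
      fix x y c assume "x \<in> mspace ?X" "y \<in> mspace ?X" "c \<in> mspace ?X" "mdist ?X x y \<le> n"
      then have "div_at ?X 6 \<delta> x y c \<le> ennreal (14 * mdist ?X x y + 54)"
        and "14 * mdist ?X x y + 54 \<le> 54 * n + 54"
        using div n by (auto simp: mspace_realization)
      then show "div_at ?X 6 \<delta> x y c \<le> ennreal (54 * n + 54)"
        using ennreal_leI order.trans by blast
    qed
    then show ?thesis
      by (simp add: add_increasing)
  qed
  then have "preceq (Div ?X 6 \<delta>) (\<lambda>n. ennreal n)"
    unfolding preceq_def by (intro exI[of _ 54]) auto
  moreover have "preceq (\<lambda>n. ennreal n) (Div ?X 6 \<delta>)"
    unfolding preceq_def by (intro exI[of _ 1]) (auto intro!: add_increasing ennreal_leI)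
  ultimately show ?thesis
    unfolding linear_divergence_def asymp_equiv_fun_def
    using \<delta> by (intro exI[of _ \<delta>] exI[of _ 6]) auto
qed

end


theorem proposition2:
  fixes A :: "'a graph" and B :: "'b graph" and I :: "'i set" and P :: "'i \<Rightarrow> 'a set" and b\<^sub>0 :: 'b
  assumes "simple_graph A" and "connected_graph A" and "locally_finite A"
    and "simple_graph B" and "connected_graph B" and "locally_finite B"
    and "\<exists>u\<in>verts B. \<exists>v\<in>verts B. u \<noteq> v"
    and "b\<^sub>0 \<in> verts B"
    and "partitions I P (verts A)"
    and "transitive_family A I P"
    and "vertex_transitive B"
    and "infinite I"
    and "locally_finite (quotient_graph A I P)"
  shows "linear_divergence (realization (wreath_product B b\<^sub>0 A I P))"
proof -
  interpret wreath A B I P b\<^sub>0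
    using assms by unfold_locales
  obtain M where "\<forall>c\<in>verts W. \<forall>x\<in>verts W. \<forall>y\<in>verts W. \<forall>N D.
      walk_le (edges W) D x y \<longrightarrow>
      (M + 1) * N \<le> graph_dist W c x \<longrightarrow> (M + 1) * N \<le> graph_dist W c y \<longrightarrow>
      walk_le (Restr (edges W) {v. N \<le> graph_dist W c v}) (4 * D + 10 * M * N + 4) x y"
    using ex_detour[OF assms(7,10,13,12)] by blast
  then show ?thesis
    by (intro linear_divergence_if_detours[OF simple_W connected_W, of M]) blast
qed

end
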